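(* Let $Q\subset\mathbb{Z}^d$ be a sharp, saturated affine semigroup generating $\mathbb{Z}^d$ as a group and $\Bbbk$ a field. If $H$ is a $\mathbb{Z}^d$-graded $\Bbbk[Q]$-module that can be expressed as the (middle) homology of a complex $J^\bullet: J'\to J\to J''$ of $\mathbb{Z}^d$-graded modules in which all three modules are injective, or all three modules are flat, then there is a sector partition $\mathcal{S}(J^\bullet)\vdash H$ determined by $J^\bullet$.
   Context: An affine semigroup is a finitely generated submonoid $Q\subset\mathbb{Z}^d$; it is sharp if its only unit is $0$; saturated if $Q$ is the set of all lattice points in the real cone it generates. $\Bbbk[Q]=\bigoplus_{a\in Q}\Bbbk\cdot\mathbf{x}^a$. Faces of $Q$ are the subsets minimizing linear functionals on $Q$; facets are faces of codimension $1$. For $S,T\subseteq\mathbb{Z}^d$, $T-S=\{\beta-\alpha\mid\alpha\in S,\beta\in T\}$. Homomorphisms have $\mathbb{Z}^d$-degree $0$. Injective module here means a finite direct sum of modules $\Bbbk\{\alpha+F-Q\}$, with $\alpha\in\mathbb{Z}^d$ and $F$ a face of $Q$, where $\Bbbk\{T\}$ has basis $\{\mathbf{x}^\beta\mid\beta\in T\}$ and $\mathbf{x}^a\mathbf{x}^\beta=\mathbf{x}^{a+\beta}$ if $a+\beta\in T$ and $0$ otherwise. (These are the injective objects in the category of $\mathbb{Z}^d$-graded modules whose graded pieces have uniformly bounded dimension.) Flat module here means a finite direct sum of the Matlis duals of such indecomposables, i.e. of modules $\Bbbk\{\alpha+Q-F\}$, which are $\mathbb{Z}^d$-graded shifts of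 the localizations $\Bbbk[Q-F]$. A sector partition $\mathcal{S}\vdash H$ of a $\mathbb{Z}^d$-graded $\Bbbk[Q]$-module $H$ consists of: (1) a finite partition $\mathbb{Z}^d=\bigsqcup_{S\in\mathcal{S}}S$ into sectors, each of which consists of the lattice points in a finite disjoint union of rational polyhedra defined as intersections of half-spaces for hyperplanes parallel to facets of $Q$; (2) a finite-dimensional $\Bbbk$-vector space $H_S$ for each $S\in\mathcal{S}$, along with isomorphisms $H_\alpha\to H_S$ for all $\alpha\in S$; (3) vector space homomorphisms $\mathbf{x}^{T-S}:H_S\to H_T$ whenever there exist $\alpha\in S$ and $\beta\in T$ with $\beta-\alpha\in Q$, such that for all choices of such $\alpha,\beta$ the square formed by multiplication $\mathbf{x}^{\beta-\alpha}:H_\alpha\to H_\beta$, the isomorphisms $H_\alpha\to H_S$ and $H_\beta\to H_T$, and $\mathbf{x}^{T-S}:H_S\to H_T$ commutes. *)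

theory Defs
  imports
    "HOL-Analysis.Analysis"
    "HOL-Library.Poly_Mapping"
    "HOL-Library.Disjoint_Sets"
    "HOL-Algebra.AbelCoset"
    "HOL-Computational_Algebra.Group_Closure"
    "Jordan_Normal_Form.Missing_VectorSpace"
begin

section \<open>Affine semigroups, faces and facets\<close>

definition real_vec :: "int ^ 'd \<Rightarrow> real ^ 'd"
  where "real_vec a = (\<chi> i. of_int (a $ i))"

definition is_submonoid :: "'a::comm_monoid_add set \<Rightarrow> bool"
  where "is_submonoid Q \<longleftrightarrow> 0 \<in> Q \<and> (\<forall>a\<in>Q. \<forall>b\<in>Q. a + b \<in> Q)"

definition affine_semigroup :: "(int ^ 'd) set \<Rightarrow> bool"
  where "affine_semigroup Q \<longleftrightarrow> (\<exists>A. finite A \<and> Q = is_submonoid hull A)"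

definition sharp :: "(int ^ 'd) set \<Rightarrow> bool"
  where "sharp Q \<longleftrightarrow> (\<forall>a\<in>Q. - a \<in> Q \<longrightarrow> a = 0)"

definition saturated :: "(int ^ 'd) set \<Rightarrow> bool"
  where "saturated Q \<longleftrightarrow> Q = {a. real_vec a \<in> convex_cone hull (real_vec ` Q)}"

text \<open>A functional that is unbounded below on \<open>Q\<close> has no minimum and defines no face,
  hence the condition \<open>F \<noteq> {}\<close>.\<close>

definition face :: "(int ^ 'd) set \<Rightarrow> (int ^ 'd) set \<Rightarrow> bool"
  where "face Q F \<longleftrightarrow> F \<noteq> {} \<and>
    (\<exists>f :: real ^ 'd \<Rightarrow> real. linear f \<and>
      F = {q \<in> Q. \<forall>p\<in>Q. f (real_vec q) \<le> f (real_vec p)})"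

definition facet :: "(int ^ 'd) set \<Rightarrow> (int ^ 'd) set \<Rightarrow> bool"
  where "facet Q F \<longleftrightarrow> face Q F \<and>
    Real_Vector_Spaces.dim (real_vec ` F) + 1 = Real_Vector_Spaces.dim (real_vec ` Q)"

section \<open>Graded modules over the semigroup ring\<close>

text \<open>The type \<open>(int ^ 'd) \<Rightarrow>\<^sub>0 'k\<close> with convolution is the group algebra of
  \<open>\<int>\<^sup>d\<close>; the monomial \<open>c \<cdot> x\<^sup>a\<close> is \<open>Poly_Mapping.single a c\<close>, and \<open>\<k>[Q]\<close> is the
  subring of elements supported on \<open>Q\<close>.\<close>

definition semigroup_ring :: "(int ^ 'd) set \<Rightarrow> ((int ^ 'd) \<Rightarrow>\<^sub>0 'k::field) ring"
  where "semigroup_ring Q =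
    \<lparr>carrier = {p. Poly_Mapping.keys p \<subseteq> Q}, mult = (*), one = 1, zero = 0, add = (+)\<rparr>"

definition base_field :: "'k::field ring"
  where "base_field = \<lparr>carrier = UNIV, mult = (*), one = 1, zero = 0, add = (+)\<rparr>"

text \<open>As for every \<open>module\<close> record, the fields \<open>mult\<close> and \<open>one\<close> of the records below
  carry no meaning.\<close>

record ('r, 'm, 'g) graded_module = "('r, 'm) module" +
  gpiece :: "'g \<Rightarrow> 'm set"

type_synonym ('k, 'd, 'm) zd_module =
  "((int, 'd) vec \<Rightarrow>\<^sub>0 'k, 'm, (int, 'd) vec) graded_module"

definition is_graded_module ::
    "(int ^ 'd) set \<Rightarrow> ('k::field, 'd, 'm) zd_module \<Rightarrow> bool"
  where "is_graded_module Q M \<longleftrightarrow>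
    Module.module (semigroup_ring Q) M \<and>
    (\<forall>a. additive_subgroup (gpiece M a) M) \<and>
    (\<forall>a. \<forall>q\<in>Q. \<forall>c. \<forall>v\<in>gpiece M a. Poly_Mapping.single q c \<odot>\<^bsub>M\<^esub> v \<in> gpiece M (a + q)) \<and>
    (\<forall>v\<in>carrier M. \<exists>!f. (\<forall>a. f a \<in> gpiece M a) \<and> finite {a. f a \<noteq> \<zero>\<^bsub>M\<^esub>} \<and>
        v = finsum M f {a. f a \<noteq> \<zero>\<^bsub>M\<^esub>})"

definition graded_hom ::
    "(int ^ 'd) set \<Rightarrow> ('k::field, 'd, 'm) zd_module \<Rightarrow> ('k, 'd, 'n) zd_module \<Rightarrow> ('m \<Rightarrow> 'n) set"
  where "graded_hom Q M N =
    {f \<in> LinearCombinations.module_hom (semigroup_ring Q) M N. \<forall>a. f ` gpiece M a \<subseteq> gpiece N a}"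

definition graded_iso ::
    "(int ^ 'd) set \<Rightarrow> ('k::field, 'd, 'm) zd_module \<Rightarrow> ('k, 'd, 'n) zd_module \<Rightarrow> ('m \<Rightarrow> 'n) set"
  where "graded_iso Q M N = {f \<in> graded_hom Q M N. bij_betw f (carrier M) (carrier N)}"

text \<open>The graded piece \<open>M\<^sub>a\<close> as a \<open>\<k>\<close>-vector space.\<close>

definition piece_space :: "('k::field, 'd, 'm) zd_module \<Rightarrow> int ^ 'd \<Rightarrow> ('k, 'm) module"
  where "piece_space M a =
    \<lparr>carrier = gpiece M a, mult = undefined, one = undefined, zero = \<zero>\<^bsub>M\<^esub>, add = add M,
     smult = (\<lambda>c v. Poly_Mapping.single 0 c \<odot>\<^bsub>M\<^esub> v)\<rparr>"

section \<open>Injective and flat modules\<close>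

text \<open>\<open>\<k>{T}\<close>: multiply in the group algebra, then discard the monomials outside \<open>T\<close>.\<close>

definition monomial_module :: "(int ^ 'd) set \<Rightarrow> ('k::field, 'd, (int ^ 'd) \<Rightarrow>\<^sub>0 'k) zd_module"
  where "monomial_module T =
    \<lparr>carrier = {v. Poly_Mapping.keys v \<subseteq> T}, mult = undefined, one = undefined, zero = 0, add = (+),
     smult = (\<lambda>r v. Poly_Mapping.mapp (\<lambda>b c. if b \<in> T then c else 0) (r * v)),
     gpiece = (\<lambda>b. {v. Poly_Mapping.keys v \<subseteq> T \<inter> {b}})\<rparr>"

definition direct_sum :: "'i set \<Rightarrow> ('i \<Rightarrow> ('k::field, 'd::finite, 'm) zd_module) \<Rightarrow> ('k, 'd, 'i \<Rightarrow> 'm) zd_module"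
  where "direct_sum I M =
    \<lparr>carrier = (\<Pi>\<^sub>E i\<in>I. carrier (M i)), mult = undefined, one = undefined,
     zero = (\<lambda>i\<in>I. \<zero>\<^bsub>M i\<^esub>), add = (\<lambda>u v. \<lambda>i\<in>I. u i \<oplus>\<^bsub>M i\<^esub> v i),
     smult = (\<lambda>r v. \<lambda>i\<in>I. r \<odot>\<^bsub>M i\<^esub> v i),
     gpiece = (\<lambda>a. \<Pi>\<^sub>E i\<in>I. gpiece (M i) a)\<rparr>"

text \<open>The set \<open>\<alpha> + T - S\<close>.\<close>

definition shifted_diff :: "int ^ 'd \<Rightarrow> (int ^ 'd) set \<Rightarrow> (int ^ 'd) set \<Rightarrow> (int ^ 'd) set"
  where "shifted_diff \<alpha> T S = {\<alpha> + (b - a) | a b. a \<in> S \<and> b \<in> T}"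

definition injective_module :: "(int ^ 'd) set \<Rightarrow> ('k::field, 'd, 'm) zd_module \<Rightarrow> bool"
  where "injective_module Q M \<longleftrightarrow>
    (\<exists>(n::nat) \<alpha> F. (\<forall>i<n. face Q (F i)) \<and>
      graded_iso Q M (direct_sum {..<n} (\<lambda>i. monomial_module (shifted_diff (\<alpha> i) (F i) Q))) \<noteq> {})"

definition flat_module :: "(int ^ 'd) set \<Rightarrow> ('k::field, 'd, 'm) zd_module \<Rightarrow> bool"
  where "flat_module Q M \<longleftrightarrow>
    (\<exists>(n::nat) \<alpha> F. (\<forall>i<n. face Q (F i)) \<and>
      graded_iso Q M (direct_sum {..<n} (\<lambda>i. monomial_module (shifted_diff (\<alpha> i) Q (F i)))) \<noteq> {})"

section \<open>Complexes and homology\<close>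

definition graded_complex ::
    "(int ^ 'd) set \<Rightarrow> ('k::field, 'd, 'l) zd_module \<Rightarrow> ('l \<Rightarrow> 'm) \<Rightarrow> ('k, 'd, 'm) zd_module \<Rightarrow>
     ('m \<Rightarrow> 'n) \<Rightarrow> ('k, 'd, 'n) zd_module \<Rightarrow> bool"
  where "graded_complex Q J' d' J d J'' \<longleftrightarrow>
    is_graded_module Q J' \<and> is_graded_module Q J \<and> is_graded_module Q J'' \<and>
    d' \<in> graded_hom Q J' J \<and> d \<in> graded_hom Q J J'' \<and>
    (\<forall>v\<in>carrier J'. d (d' v) = \<zero>\<^bsub>J''\<^esub>)"

text \<open>\<open>ker d / im d'\<close>; its elements are the cosets of \<open>im d'\<close>.\<close>

definition middle_homology ::
    "('k::field, 'd, 'l) zd_module \<Rightarrow> ('l \<Rightarrow> 'm) \<Rightarrow> ('k, 'd, 'm) zd_module \<Rightarrow>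
     ('m \<Rightarrow> 'n) \<Rightarrow> ('k, 'd, 'n) zd_module \<Rightarrow> ('k, 'd, 'm set) zd_module"
  where "middle_homology J' d' J d J'' =
    (let B = d' ` carrier J'; Z = a_kernel J J'' d in
      \<lparr>carrier = (\<lambda>z. B +>\<^bsub>J\<^esub> z) ` Z, mult = undefined, one = undefined,
       zero = B, add = set_add J,
       smult = (\<lambda>r C. \<Union>z\<in>C. B +>\<^bsub>J\<^esub> (r \<odot>\<^bsub>J\<^esub> z)),
       gpiece = (\<lambda>a. (\<lambda>z. B +>\<^bsub>J\<^esub> z) ` (Z \<inter> gpiece J a))\<rparr>)"

section \<open>Sector partitions\<close>

text \<open>The hyperplane \<open>{x. \<tau> \<bullet> x = c}\<close> is parallel to the facet \<open>F\<close> when its normal \<open>\<tau>\<close>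
  is orthogonal to \<open>F\<close>. Both signs of \<open>\<tau>\<close> are allowed, so both sides of the hyperplane occur.\<close>

definition facet_halfspace :: "(int ^ 'd) set \<Rightarrow> (real ^ 'd) set \<Rightarrow> bool"
  where "facet_halfspace Q h \<longleftrightarrow>
    (\<exists>F \<tau> c. facet Q F \<and> \<tau> \<noteq> 0 \<and> (\<forall>i. \<tau> $ i \<in> \<rat>) \<and> c \<in> \<rat> \<and>
      (\<forall>a\<in>F. \<tau> \<bullet> real_vec a = 0) \<and> h = {x. \<tau> \<bullet> x \<ge> c})"

definition facet_polyhedron :: "(int ^ 'd) set \<Rightarrow> (real ^ 'd) set \<Rightarrow> bool"
  where "facet_polyhedron Q P \<longleftrightarrow>
    (\<exists>\<H>. finite \<H> \<and> (\<forall>h\<in>\<H>. facet_halfspace Q h) \<and> P = \<Inter>\<H>)"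

definition is_sector :: "(int ^ 'd) set \<Rightarrow> (int ^ 'd) set \<Rightarrow> bool"
  where "is_sector Q S \<longleftrightarrow>
    (\<exists>\<P>. finite \<P> \<and> disjoint \<P> \<and> (\<forall>P\<in>\<P>. facet_polyhedron Q P) \<and>
      S = {a. real_vec a \<in> \<Union>\<P>})"

text \<open>\<open>\<S>\<close> is the set of sectors, \<open>V S\<close> the space \<open>H\<^sub>S\<close>, \<open>\<phi> \<alpha>\<close> the isomorphism
  \<open>H\<^sub>\<alpha> \<rightarrow> H\<^sub>S\<close> for the sector \<open>S\<close> containing \<open>\<alpha>\<close>, and \<open>X S T\<close> the map \<open>x\<^bsup>T - S\<^esup>\<close>.\<close>

definition sector_partition ::
    "(int ^ 'd) set \<Rightarrow> ('k::field, 'd, 'h) zd_module \<Rightarrow> (int ^ 'd) set set \<Rightarrow>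
     ((int ^ 'd) set \<Rightarrow> ('k, 'v) module) \<Rightarrow> (int ^ 'd \<Rightarrow> 'h \<Rightarrow> 'v) \<Rightarrow>
     ((int ^ 'd) set \<Rightarrow> (int ^ 'd) set \<Rightarrow> 'v \<Rightarrow> 'v) \<Rightarrow> bool"
  where "sector_partition Q H \<S> V \<phi> X \<longleftrightarrow>
    finite \<S> \<and> partition_on UNIV \<S> \<and> (\<forall>S\<in>\<S>. is_sector Q S) \<and>
    (\<forall>S\<in>\<S>. vectorspace base_field (V S) \<and> vectorspace.fin_dim base_field (V S) \<and>
      (\<forall>\<alpha>\<in>S. \<phi> \<alpha> \<in> LinearCombinations.module_hom base_field (piece_space H \<alpha>) (V S) \<and>
             bij_betw (\<phi> \<alpha>) (gpiece H \<alpha>) (carrier (V S)))) \<and>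
    (\<forall>S\<in>\<S>. \<forall>T\<in>\<S>. (\<exists>\<alpha>\<in>S. \<exists>\<beta>\<in>T. \<beta> - \<alpha> \<in> Q) \<longrightarrow>
      X S T \<in> LinearCombinations.module_hom base_field (V S) (V T) \<and>
      (\<forall>\<alpha>\<in>S. \<forall>\<beta>\<in>T. \<beta> - \<alpha> \<in> Q \<longrightarrow>
        (\<forall>v\<in>gpiece H \<alpha>. X S T (\<phi> \<alpha> v) = \<phi> \<beta> (Poly_Mapping.single (\<beta> - \<alpha>) 1 \<odot>\<^bsub>H\<^esub> v))))"

end

theory Submission
  imports Defs
begin

text \<open>
  Write each module as a sum of \<open>\<k>{T\<^sub>i}\<close>, and let the pattern of a degree \<open>a\<close> be the set of
  indices \<open>i\<close> (for all three modules) with \<open>a \<in> T\<^sub>i\<close>; the sectors are the classes of equal pattern.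

  Geometry: for a face \<open>F\<close>, a separating functional for \<open>a \<notin> F - Q\<close> can be rotated until it is an integral
  facet normal. So every \<open>T\<^sub>i\<close> is cut out by finitely many integral facet inequalities, and the patterns
  are unions of cells of a finite arrangement.

  Algebra: for all degrees \<open>a\<close>, \<open>b\<close> there is a transport \<open>J\<^sub>a \<rightarrow> J\<^sub>b\<close> sending \<open>x\<^sup>a e\<^sub>i\<close> to
  \<open>x\<^sup>b e\<^sub>i\<close> or \<open>0\<close>, which is multiplication by \<open>x\<^bsup>b - a\<^esup>\<close> when \<open>b - a \<in> Q\<close>. If \<open>a\<close> and \<open>b\<close> have the same
  pattern, it commutes with the differentials: compare both degrees with a common lower bound
  (injective case) or upper bound (flat case), which exists because \<open>Q\<close> generates the lattice. Hence
  transport descends to homology.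
\<close>

subsection \<open>Lattice vectors and integral pairings\<close>

text \<open>Two degrees of one sector need not differ by an element of \<open>Q\<close>, so
  multiplication gives no direct map between the corresponding pieces of the homology. This is why
  transport is built on the summands, where basis vectors can be matched degree by degree. Transport
  is not functorial: going from \<open>a\<close> through \<open>b\<close> to \<open>c\<close> loses
  exactly the summands present at \<open>a\<close> and \<open>c\<close> but absent at
  \<open>b\<close>. Every composition is therefore licensed by
  \<open>\<sigma> a \<inter> \<sigma> c \<subseteq> \<sigma> b\<close>, and this condition shapes
  the two cases. Regions \<open>\<alpha> + F - Q\<close> are closed under subtracting elements of
  \<open>Q\<close>, so a detour through a lower degree loses nothing; regions
  \<open>\<alpha> + Q - F\<close> are closed under adding them, so a detour through a higher degree
  loses nothing. Patterns record all three modules because cycles are governed by \<open>d\<close>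
  and boundaries by \<open>d'\<close>. Saturation enters at one point: it turns a lattice point of
  the real cone into an element of \<open>Q\<close>, so that real inequalities describe
  \<open>F - Q\<close> without gaps.\<close>

lemma real_vec_0 [simp]: "real_vec 0 = 0"
  and real_vec_add: "real_vec (a + b) = real_vec a + real_vec b"
  and real_vec_diff: "real_vec (a - b) = real_vec a - real_vec b"
  and real_vec_minus: "real_vec (- a) = - real_vec a"
  by (simp_all add: real_vec_def vec_eq_iff)

lemma real_vec_eq_0_iff [simp]: "real_vec a = 0 \<longleftrightarrow> a = 0"
  by (simp add: real_vec_def vec_eq_iff)

lemma real_vec_axis: "real_vec (axis i 1) = axis i 1"
  by (simp add: real_vec_def axis_def vec_eq_iff)

definition int_pairing :: "int ^ 'd \<Rightarrow> int ^ 'd \<Rightarrow> int"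
  where "int_pairing t a = (\<Sum>i\<in>UNIV. t $ i * a $ i)"

lemma real_vec_inner: "real_vec t \<bullet> real_vec a = of_int (int_pairing t a)"
  by (simp add: real_vec_def int_pairing_def inner_vec_def)

lemma int_pairing_diff: "int_pairing t (a - b) = int_pairing t a - int_pairing t b"
  and int_pairing_uminus: "int_pairing (- t) a = - int_pairing t a"
  and int_pairing_0 [simp]: "int_pairing t 0 = 0"
  by (simp_all add: int_pairing_def algebra_simps sum_subtractf sum_negf)

lemma of_int_det:
  "of_int (det (N :: int ^ 'n ^ 'n)) = det ((\<chi> i j. of_int (N $ i $ j)) :: real ^ 'n ^ 'n)"
  by (simp add: det_def)

text \<open>Expansion along row \<open>k\<close>: the determinant is linear in that row, and its
  values at the unit vectors form the integer vector of cofactors that represents it.\<close>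

lemma int_pairing_cofactor:
  fixes g :: "'d::finite \<Rightarrow> int ^ 'd"
  shows "int_pairing (\<chi> j. det (\<chi> i. if i = k then axis j 1 else g i)) x
    = det (\<chi> i. if i = k then x else g i)"
proof -
  have x: "x = (\<Sum>j\<in>UNIV. x $ j *s axis j 1)"
    by (simp add: vec_eq_iff axis_def if_distrib sum.delta cong: if_cong)
  have "det (\<chi> i. if i = k then x else g i)
    = det (\<chi> i. if i = k then \<Sum>j\<in>UNIV. x $ j *s axis j 1 else g i)"
    by (rule arg_cong[OF x])
  also have "\<dots> = (\<Sum>j\<in>UNIV. det (\<chi> i. if i = k then x $ j *s axis j 1 else g i))"
    by (rule det_linear_row_sum) simp
  also have "\<dots> = (\<Sum>j\<in>UNIV. x $ j * det (\<chi> i. if i = k then axis j 1 else g i))"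
    by (simp only: det_row_mul)
  finally show ?thesis by (simp add: int_pairing_def mult.commute)
qed

text \<open>An independent subset of \<open>B\<close> with the same span is completed by lattice
  vectors to a basis of the real space, and one of the added vectors is made variable in the
  determinant. The resulting functional has integer coefficients, vanishes on the other basis
  vectors because a row is repeated, and is nonzero at the vector it replaces.\<close>

lemma integral_normal_exists:
  fixes B :: "(int ^ 'd) set"
  assumes "Real_Vector_Spaces.dim (real_vec ` B) < CARD('d)"
  obtains t where "t \<noteq> 0" "\<And>b. b \<in> B \<Longrightarrow> int_pairing t b = 0"
proof -
  obtain B' where B': "B' \<subseteq> real_vec ` B" "Real_Vector_Spaces.independent B'"
      "real_vec ` B \<subseteq> Real_Vector_Spaces.span B'"
      "card B' = Real_Vector_Spaces.dim (real_vec ` B)"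
    by (rule real_vector.basis_exists)
  obtain C where C: "B' \<subseteq> C" "C \<subseteq> range real_vec" "Real_Vector_Spaces.independent C"
      "range real_vec \<subseteq> Real_Vector_Spaces.span C"
    using real_vector.maximal_independent_subset_extend[of B' "range real_vec"] B'(1,2) by blast
  have "Basis \<subseteq> (range real_vec :: (real ^ 'd) set)"
    by (auto simp: Basis_vec_def simp flip: real_vec_axis)
  then have spanC: "Real_Vector_Spaces.span C = UNIV"
    using C(4) by (metis real_vector.span_mono real_vector.span_span span_Basis order.trans top.extremum_unique)
  have cardC: "card C = CARD('d)"
    using real_vector.dim_eq_card[OF _ C(3), of UNIV] spanC by simp
  have finC: "finite C"
    using cardC card.infinite by fastforce
  obtain f where f: "bij_betw f (UNIV :: 'd set) C"
    using finite_same_card_bij[of "UNIV :: 'd set" C] finC cardC by auto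
  define g where "g i = (SOME a. real_vec a = f i)" for i
  have g: "real_vec (g i) = f i" for i
  proof -
    have "f i \<in> range real_vec" using f C(2) by (auto simp: bij_betw_def)
    then show ?thesis unfolding g_def by (metis (mono_tags) imageE someI)
  qed
  have "B' \<noteq> C" using B'(4) assms cardC by auto
  then obtain k where k: "f k \<notin> B'"
    using f C(1) by (auto simp: bij_betw_def)
  define t where "t = (\<chi> j. det (\<chi> i. if i = k then axis j 1 else g i))"
  have t: "int_pairing t x = det (\<chi> i. if i = k then x else g i)" for x
    unfolding t_def by (rule int_pairing_cofactor)
  have "(\<chi> i. if i = k then g k else g i) = (\<chi> i. g i)" by (simp add: vec_eq_iff)
  then have "of_int (int_pairing t (g k)) = det ((\<chi> i. f i) :: real ^ 'd ^ 'd)"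
    by (simp add: t of_int_det flip: g) (simp add: real_vec_def)
  moreover have "rows ((\<chi> i. f i) :: real ^ 'd ^ 'd) = C"
    using f by (auto simp: rows_def row_def bij_betw_def)
  then have "det ((\<chi> i. f i) :: real ^ 'd ^ 'd) \<noteq> 0"
    using spanC by (metis invertible_det_nz invertible_left_inverse matrix_left_invertible_span_rows)
  ultimately have "t \<noteq> 0" by (auto simp: int_pairing_def)
  moreover have "int_pairing t b = 0" if "b \<in> B" for b
  proof -
    have "real_vec t \<bullet> y = 0" if y: "y \<in> B'" for y
    proof -
      obtain i where i: "f i = y" using f C(1) y by (auto simp: bij_betw_def)
      then have "i \<noteq> k" using k y by auto
      then have "det (\<chi> j. if j = k then g i else g j) = 0"
        by (intro det_identical_rows[of i k]) (auto simp: row_def)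
      then show ?thesis using real_vec_inner[of t "g i"] t g i by simp
    qed
    then have "B' \<subseteq> {y. real_vec t \<bullet> y = 0}" by auto
    then have "Real_Vector_Spaces.span B' \<subseteq> {y. real_vec t \<bullet> y = 0}"
      by (rule real_vector.span_minimal) (rule subspace_hyperplane)
    then have "real_vec t \<bullet> real_vec b = 0" using B'(3) that by blast
    then show ?thesis by (simp add: real_vec_inner)
  qed
  ultimately show thesis by (rule that)
qed

text \<open>Move a separating functional along a direction that keeps its value at \<open>a\<close> and its
  zeros until a further generator becomes a zero.\<close>

lemma separating_functional_max_zeros:
  fixes A :: "'a::euclidean_space set"
  assumes "finite A" "Real_Vector_Spaces.span A = UNIV"
    and "t \<bullet> a > 0" "\<And>g. g \<in> A \<Longrightarrow> t \<bullet> g \<ge> 0"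
  shows "\<exists>s. s \<bullet> a > 0 \<and> (\<forall>g\<in>A. s \<bullet> g \<ge> 0) \<and> (\<forall>g\<in>A. t \<bullet> g = 0 \<longrightarrow> s \<bullet> g = 0)
    \<and> Real_Vector_Spaces.dim {g \<in> A. s \<bullet> g = 0} + 1 = DIM('a)"
  using assms(3,4)
proof (induction "DIM('a) - Real_Vector_Spaces.dim {g \<in> A. t \<bullet> g = 0}" arbitrary: t rule: less_induct)
  case less
  let ?Z = "{g \<in> A. t \<bullet> g = 0}"
  have t0: "t \<noteq> 0" using less.prems by auto
  have "Real_Vector_Spaces.dim ?Z \<le> Real_Vector_Spaces.dim {x. t \<bullet> x = 0}"
    by (rule dim_subset) auto
  also have "\<dots> = DIM('a) - 1" using t0 by (rule dim_hyperplane)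
  finally have le: "Real_Vector_Spaces.dim ?Z + 1 \<le> DIM('a)"
    using DIM_positive[where 'a='a] by linarith
  show ?case
  proof (cases "Real_Vector_Spaces.dim ?Z + 1 = DIM('a)")
    case True
    then show ?thesis using less.prems by blast
  next
    case False
    \<comment> \<open>At least two dimensions are missing, so a direction orthogonal to all present
      zeros remains even after orthogonality to \<open>a\<close> is imposed.\<close>
    then have "Real_Vector_Spaces.dim (insert a ?Z) < DIM('a)"
      using le by (simp add: dim_insert)
    then obtain u0 where u0: "u0 \<noteq> 0" "\<And>y. y \<in> Real_Vector_Spaces.span (insert a ?Z) \<Longrightarrow> orthogonal u0 y"
      by (rule orthogonal_to_subspace_exists) blast
    have u0': "u0 \<bullet> a = 0" "\<And>g. g \<in> ?Z \<Longrightarrow> u0 \<bullet> g = 0"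
      using u0(2)[OF real_vector.span_base] by (auto simp: orthogonal_def)
    have "\<exists>g\<in>A. u0 \<bullet> g \<noteq> 0"
    proof (rule ccontr)
      assume "\<not> ?thesis"
      then have "A \<subseteq> {x. u0 \<bullet> x = 0}" by auto
      then have "Real_Vector_Spaces.span A \<subseteq> {x. u0 \<bullet> x = 0}"
        by (rule real_vector.span_minimal) (rule subspace_hyperplane)
      then have "u0 \<bullet> u0 = 0" using assms(2) by blast
      then show False using u0(1) by simp
    qed
    then obtain g1 where g1: "g1 \<in> A" "u0 \<bullet> g1 \<noteq> 0" by blast
    \<comment> \<open>The sign is chosen so that some generator decreases along \<open>u\<close>;
      otherwise the motion might never produce a new zero.\<close>
    define u where "u = (if u0 \<bullet> g1 < 0 then u0 else - u0)"
    have u: "u \<bullet> a = 0" "\<And>g. g \<in> ?Z \<Longrightarrow> u \<bullet> g = 0" "u \<bullet> g1 < 0"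
      using u0' g1 by (auto simp: u_def)
    let ?N = "{g \<in> A. u \<bullet> g < 0}"
    \<comment> \<open>The ratio test: \<open>r\<close> is the largest step that keeps all generators
      nonnegative, and a generator attaining the minimum becomes a zero.\<close>
    define r where "r = Min ((\<lambda>g. (t \<bullet> g) / - (u \<bullet> g)) ` ?N)"
    have N: "finite ?N" "?N \<noteq> {}" using assms(1) g1 u by auto
    have rle: "r \<le> (t \<bullet> g) / - (u \<bullet> g)" if "g \<in> ?N" for g
      unfolding r_def using N that by (intro Min_le) auto
    have "r \<in> (\<lambda>g. (t \<bullet> g) / - (u \<bullet> g)) ` ?N"
      unfolding r_def using N by (intro Min_in) auto
    then obtain g0 where g0: "g0 \<in> ?N" "r = (t \<bullet> g0) / - (u \<bullet> g0)" by blast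
    have r0: "r \<ge> 0" using g0 less.prems(2)[of g0] by (simp add: divide_nonneg_neg zero_le_divide_iff)
    define s where "s = t + r *\<^sub>R u"
    have sg: "s \<bullet> g = t \<bullet> g + r * (u \<bullet> g)" for g by (simp add: s_def inner_add_left)
    have "s \<bullet> a > 0" using less.prems u by (simp add: sg)
    moreover have nonneg: "s \<bullet> g \<ge> 0" if "g \<in> A" for g
    proof (cases "u \<bullet> g < 0")
      case True
      then show ?thesis using rle[of g] that by (simp add: sg field_simps)
    next
      case False
      then show ?thesis using r0 less.prems(2)[OF that] by (simp add: sg)
    qed
    moreover have "Real_Vector_Spaces.dim ?Z < Real_Vector_Spaces.dim {g \<in> A. s \<bullet> g = 0}"
    proof -
      have "s \<bullet> g0 = 0" using g0 by (simp add: sg field_simps)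
      then have "insert g0 ?Z \<subseteq> {g \<in> A. s \<bullet> g = 0}"
        using g0 u(2) by (auto simp: sg)
      then have "Real_Vector_Spaces.dim (insert g0 ?Z) \<le> Real_Vector_Spaces.dim {g \<in> A. s \<bullet> g = 0}"
        by (rule dim_subset)
      \<comment> \<open>\<open>u\<close> vanishes on the old zeros but not at \<open>g0\<close>, so
        the new zero is independent of them and the induction measure drops.\<close>
      moreover have "g0 \<notin> Real_Vector_Spaces.span ?Z"
      proof
        assume "g0 \<in> Real_Vector_Spaces.span ?Z"
        moreover have "Real_Vector_Spaces.span ?Z \<subseteq> {x. u \<bullet> x = 0}"
          using u(2) by (intro real_vector.span_minimal subspace_hyperplane) auto
        ultimately show False using g0 by auto
      qed
      ultimately show ?thesis by (simp add: dim_insert)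
    qed
    then have "DIM('a) - Real_Vector_Spaces.dim {g \<in> A. s \<bullet> g = 0} < DIM('a) - Real_Vector_Spaces.dim ?Z"
      using le by linarith
    ultimately obtain s' where s': "s' \<bullet> a > 0" "\<forall>g\<in>A. s' \<bullet> g \<ge> 0" 
        "\<forall>g\<in>A. s \<bullet> g = 0 \<longrightarrow> s' \<bullet> g = 0"
        "Real_Vector_Spaces.dim {g \<in> A. s' \<bullet> g = 0} + 1 = DIM('a)"
      using less.hyps[of s] by blast
    moreover have "\<forall>g\<in>A. t \<bullet> g = 0 \<longrightarrow> s' \<bullet> g = 0"
      using s'(3) u(2) by (auto simp: sg)
    ultimately show ?thesis by blast
  qed
qed

subsection \<open>Facet normals and sectors\<close>

text \<open>The sign is left free, so that a normal and its negative provide the two sides of one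
  hyperplane.\<close>

definition facet_normal :: "(int ^ 'd) set \<Rightarrow> int ^ 'd \<Rightarrow> bool"
  where "facet_normal Q t \<longleftrightarrow> t \<noteq> 0 \<and> (\<exists>F. facet Q F \<and> (\<forall>a\<in>F. int_pairing t a = 0))"

lemma facet_normal_minus: "facet_normal Q t \<Longrightarrow> facet_normal Q (- t)"
  by (auto simp: facet_normal_def int_pairing_uminus)

lemma facet_halfspace_integral:
  assumes "facet_normal Q t"
  shows "facet_halfspace Q {x. real_vec t \<bullet> x \<ge> of_int c}"
proof -
  obtain F where F: "facet Q F" "\<forall>a\<in>F. int_pairing t a = 0" and t: "t \<noteq> 0"
    using assms by (auto simp: facet_normal_def)
  have "\<forall>i. real_vec t $ i \<in> \<rat>" by (simp add: real_vec_def)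
  moreover have "\<forall>a\<in>F. real_vec t \<bullet> real_vec a = 0" using F by (simp add: real_vec_inner)
  ultimately show ?thesis unfolding facet_halfspace_def using F(1) t
    by (intro exI[of _ F] exI[of _ "real_vec t"] exI[of _ "of_int c"]) auto
qed

text \<open>The cells of the arrangement given by the truth values of \<open>int_pairing t a \<le> c\<close>, the negation
  being replaced by \<open>int_pairing t a \<ge> c + 1\<close>, come from polyhedra that are disjoint even as
  subsets of the real space.\<close>

lemma is_sector_if_determined:
  fixes Q :: "(int ^ 'd) set" and K :: "((int ^ 'd) \<times> int) set"
  assumes "finite K" and normal: "\<And>t c. (t, c) \<in> K \<Longrightarrow> facet_normal Q t"
    and det: "\<And>a b. \<lbrakk>\<And>t c. (t, c) \<in> K \<Longrightarrow> int_pairing t a \<le> c \<longleftrightarrow> int_pairing t b \<le> c; a \<in> S\<rbrakk> \<Longrightarrow> b \<in> S"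
  shows "is_sector Q S"
proof -
  define s where "s a = {(t, c) \<in> K. int_pairing t a \<le> c}" for a
  \<comment> \<open>Half-spaces are given by lower bounds, so an upper bound is written with the
    opposite normal and the opposite constant.\<close>
  define lo where "lo p = {x. real_vec (- fst p) \<bullet> x \<ge> of_int (- snd p)}" for p :: "(int ^ 'd) \<times> int"
  define up where "up p = {x. real_vec (fst p) \<bullet> x \<ge> of_int (snd p + 1)}" for p :: "(int ^ 'd) \<times> int"
  define P where "P L = \<Inter> (lo ` L \<union> up ` (K - L))" for L
  have lo_up: "x \<notin> up p" if "x \<in> lo p" for x p
    using that by (auto simp: lo_def up_def real_vec_minus)
  have mem_lo: "real_vec a \<in> lo p \<longleftrightarrow> int_pairing (fst p) a \<le> snd p"
    and mem_up: "real_vec a \<in> up p \<longleftrightarrow> \<not> int_pairing (fst p) a \<le> snd p" for a p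
    unfolding lo_def up_def mem_Collect_eq real_vec_inner of_int_le_iff
    by (auto simp: int_pairing_uminus)
  have mem_P: "real_vec a \<in> P L \<longleftrightarrow> s a = L" if "L \<subseteq> K" for a L
  proof -
    have "real_vec a \<in> P L \<longleftrightarrow> (\<forall>p\<in>L. int_pairing (fst p) a \<le> snd p)
        \<and> (\<forall>p\<in>K - L. \<not> int_pairing (fst p) a \<le> snd p)"
      unfolding P_def by (simp add: mem_lo mem_up ball_Un)
    moreover have "s a = {p \<in> K. int_pairing (fst p) a \<le> snd p}" by (auto simp: s_def)
    ultimately show ?thesis using that by blast
  qed
  have disj: "P L \<inter> P L' = {}" if L: "L \<subseteq> K" "L' \<subseteq> K" "L \<noteq> L'" for L L'
  proof -
    have *: "P L \<inter> P L' = {}" if "p \<in> L" "p \<notin> L'" "L \<subseteq> K" for p L L'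
    proof -
      have "P L \<subseteq> lo p" "P L' \<subseteq> up p" using that by (auto simp: P_def)
      then show ?thesis using lo_up by blast
    qed
    obtain p where "p \<in> L \<and> p \<notin> L' \<or> p \<in> L' \<and> p \<notin> L" using L by blast
    then show ?thesis using *[of p L L'] *[of p L' L] L by blast
  qed
  have sK: "s a \<subseteq> K" for a by (auto simp: s_def)
  have "s ` S \<subseteq> Pow K" using sK by blast
  then have fin: "finite (P ` s ` S)"
    using assms(1) by (blast intro: finite_imageI finite_subset finite_Pow_iff[THEN iffD2])
  show ?thesis unfolding is_sector_def
  \<comment> \<open>Only the cells met by \<open>S\<close> are taken; by \<open>det\<close>,
    \<open>S\<close> contains every lattice point of such a cell.\<close>
  proof (intro exI[of _ "P ` s ` S"] conjI ballI)
    show "finite (P ` s ` S)" by (rule fin)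
    show "disjoint (P ` s ` S)"
      unfolding disjoint_def
    proof (intro ballI impI)
      fix X Y assume XY: "X \<in> P ` s ` S" "Y \<in> P ` s ` S" "X \<noteq> Y"
      obtain a where a: "X = P (s a)" using XY(1) by (elim imageE) simp
      obtain b where b: "Y = P (s b)" using XY(2) by (elim imageE) simp
      have "s a \<noteq> s b" using XY(3) unfolding a b by metis
      then show "X \<inter> Y = {}" unfolding a b by (rule disj[OF sK sK])
    qed
    show "facet_polyhedron Q R" if R: "R \<in> P ` s ` S" for R
    proof -
      obtain x where "R = P (s x)" using R by (elim imageE) simp
      then obtain L where L: "L \<subseteq> K" "R = P L" using sK by blast
      have "facet_normal Q (fst p)" if "p \<in> K" for p
        using that normal[of "fst p" "snd p"] by simp
      then have "facet_halfspace Q (lo p)" "facet_halfspace Q (up p)" if "p \<in> K" for p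
        unfolding lo_def up_def
        using that facet_halfspace_integral facet_normal_minus by blast+
      then have "facet_halfspace Q h" if "h \<in> lo ` L \<union> up ` (K - L)" for h
        using that L(1) by blast
      moreover have "finite (lo ` L \<union> up ` (K - L))"
        using L assms(1) finite_subset by blast
      ultimately show ?thesis unfolding facet_polyhedron_def L(2) P_def by blast
    qed
    show "S = {a. real_vec a \<in> \<Union> (P ` s ` S)}"
    proof -
      have "real_vec a \<in> \<Union> (P ` s ` S) \<longleftrightarrow> (\<exists>b\<in>S. s a = s b)" for a
        using mem_P[OF sK] by auto
      moreover have "(\<exists>b\<in>S. s a = s b) \<longleftrightarrow> a \<in> S" for a
      proof
        assume "\<exists>b\<in>S. s a = s b"
        then obtain b where b: "b \<in> S" "s a = s b" by blast
        have "int_pairing t b \<le> c \<longleftrightarrow> int_pairing t a \<le> c" if "(t, c) \<in> K" for t c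
          using b(2) that by (auto simp: s_def set_eq_iff)
        then show "a \<in> S" using det b(1) by blast
      qed blast
      ultimately show ?thesis by auto
    qed
  qed
qed

section \<open>Submonoids, faces and separation of lattice points\<close>

lemma is_submonoid_hull: "is_submonoid (is_submonoid hull A)"
  by (rule hull_in) (auto simp: is_submonoid_def)

lemma affine_semigroup_is_submonoid: "affine_semigroup Q \<Longrightarrow> is_submonoid Q"
  by (auto simp: affine_semigroup_def is_submonoid_hull)

lemma group_closure_submonoid_diff:
  fixes Q :: "'a::ab_group_add set"
  assumes "is_submonoid Q" and "x \<in> group_closure Q"
  shows "\<exists>p\<in>Q. \<exists>q\<in>Q. x = p - q"
  using assms(2)
proof induction
  case (base s)
  have "0 \<in> Q" using assms(1) by (simp add: is_submonoid_def)
  moreover have "s \<in> Q" using base calculation by auto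
  ultimately show ?case by (metis diff_zero)
next
  case (diff s t)
  then obtain p q p' q' where "p \<in> Q" "q \<in> Q" "s = p - q" "p' \<in> Q" "q' \<in> Q" "t = p' - q'" by blast
  then show ?case using assms(1)
    by (intro bexI[of _ "p + q'"] bexI[of _ "q + p'"]) (auto simp: is_submonoid_def)
qed

text \<open>The minimum of a functional on a submonoid is 0: a minimiser \<open>q\<close> satisfies
  \<open>f q \<le> f (q + q) = 2 * f q\<close>, which makes the minimum nonnegative, and 0 lies in
  \<open>Q\<close>.\<close>

lemma face_eq_zeros:
  assumes Q: "is_submonoid Q" and "face Q F"
  obtains f :: "real ^ 'd \<Rightarrow> real" where "linear f" "\<And>q. q \<in> Q \<Longrightarrow> f (real_vec q) \<ge> 0"
    "F = {q \<in> Q. f (real_vec q) = 0}"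
proof -
  obtain f :: "real ^ 'd \<Rightarrow> real" where f: "linear f" "F \<noteq> {}"
      "F = {q \<in> Q. \<forall>p\<in>Q. f (real_vec q) \<le> f (real_vec p)}"
    using assms(2) by (auto simp: face_def)
  obtain q where q: "q \<in> Q" "\<And>p. p \<in> Q \<Longrightarrow> f (real_vec q) \<le> f (real_vec p)"
    using f by blast
  have f0: "f (real_vec 0) = 0" using linear_0[OF f(1)] by simp
  have "q + q \<in> Q" using q(1) Q unfolding is_submonoid_def by blast
  then have "f (real_vec q) \<le> f (real_vec (q + q))" by (rule q(2))
  then have "f (real_vec q) \<ge> 0" unfolding real_vec_add linear_add[OF f(1)] by simp
  then have nonneg: "f (real_vec p) \<ge> 0" if "p \<in> Q" for p using q(2)[OF that] by simp
  have "F = {q \<in> Q. f (real_vec q) = 0}"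
  proof -
    have "(\<forall>p\<in>Q. f (real_vec q) \<le> f (real_vec p)) \<longleftrightarrow> f (real_vec q) = 0" if "q \<in> Q" for q
      using nonneg nonneg[OF that] f0 Q unfolding is_submonoid_def by (metis order.antisym)
    then show ?thesis unfolding f(3) by blast
  qed
  with f(1) nonneg show thesis by (rule that)
qed

lemma span_real_vec_generators:
  fixes A :: "(int ^ 'd) set"
  assumes "group_closure (is_submonoid hull A) = UNIV"
  shows "Real_Vector_Spaces.span (real_vec ` A) = UNIV"
proof -
  let ?S = "Real_Vector_Spaces.span (real_vec ` A)"
  have hull: "real_vec q \<in> ?S" if "q \<in> is_submonoid hull A" for q
    by (rule hull_induct[OF that])
       (auto simp: is_submonoid_def real_vec_add intro: real_vector.span_base real_vector.span_add
          real_vector.span_zero)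
  have "real_vec x \<in> ?S" for x
  proof -
    obtain p q where "p \<in> is_submonoid hull A" "q \<in> is_submonoid hull A" "x = p - q"
      using group_closure_submonoid_diff[OF is_submonoid_hull, of x A] assms by auto
    then show ?thesis using hull by (simp add: real_vec_diff real_vector.span_diff)
  qed
  then have "Basis \<subseteq> ?S" by (auto simp: Basis_vec_def simp flip: real_vec_axis)
  then show ?thesis
    by (metis real_vector.span_mono real_vector.span_span span_Basis top.extremum_unique)
qed

text \<open>The zeros of \<open>t\<close> on \<open>Q\<close> form a face because 0 is the minimum.
  Its dimension is squeezed between that of \<open>B\<close> and that of the hyperplane orthogonal
  to \<open>t\<close>.\<close>

lemma facet_zeros_of_normal:
  fixes Q :: "(int ^ 'd) set"
  assumes "is_submonoid Q" and "Real_Vector_Spaces.span (real_vec ` Q) = UNIV"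
    and "t \<noteq> 0" "\<And>q. q \<in> Q \<Longrightarrow> int_pairing t q \<ge> 0"
    and "B \<subseteq> Q" "\<And>b. b \<in> B \<Longrightarrow> int_pairing t b = 0"
    and "Real_Vector_Spaces.dim (real_vec ` B) + 1 = CARD('d)"
  shows "facet_normal Q t"
proof -
  let ?G = "{q \<in> Q. int_pairing t q = 0}"
  have 0: "0 \<in> Q" using assms(1) by (auto simp: is_submonoid_def)
  have "face Q ?G" unfolding face_def
  proof (intro conjI exI)
    show "?G \<noteq> {}" using 0 by force
    show "linear ((\<bullet>) (real_vec t))" by (simp add: bounded_linear_inner_right bounded_linear.linear)
    show "?G = {q \<in> Q. \<forall>p\<in>Q. real_vec t \<bullet> real_vec q \<le> real_vec t \<bullet> real_vec p}"
      using assms(4) 0 by (force simp: real_vec_inner)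
  qed
  moreover have "Real_Vector_Spaces.dim (real_vec ` ?G) + 1 = CARD('d)"
  proof -
    have "Real_Vector_Spaces.dim (real_vec ` ?G) \<le> Real_Vector_Spaces.dim {x. real_vec t \<bullet> x = 0}"
      by (rule dim_subset) (auto simp: real_vec_inner)
    also have "\<dots> = CARD('d) - 1" using dim_hyperplane[of "real_vec t"] assms(3) by simp
    finally have 1: "Real_Vector_Spaces.dim (real_vec ` ?G) \<le> CARD('d) - 1" .
    have "Real_Vector_Spaces.dim (real_vec ` B) \<le> Real_Vector_Spaces.dim (real_vec ` ?G)"
      using assms(5,6) by (intro dim_subset) auto
    then show ?thesis using 1 assms(7) by linarith
  qed
  moreover have "Real_Vector_Spaces.dim (real_vec ` Q) = CARD('d)"
    using assms(2) by (metis DIM_cart DIM_real dim_UNIV mult.right_neutral real_vector.dim_span)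
  ultimately show ?thesis unfolding facet_normal_def facet_def using assms(3) by auto
qed

text \<open>Removing from \<open>t\<close> its projection to \<open>s\<close> leaves a vector
  orthogonal to \<open>s\<close> and to \<open>Z\<close>. Together these span the space, so the
  remainder is orthogonal to itself.\<close>

lemma parallel_if_orthogonal_to_hyperplane:
  fixes s t :: "'a::euclidean_space"
  assumes "s \<noteq> 0" "\<And>z. z \<in> Z \<Longrightarrow> s \<bullet> z = 0" "\<And>z. z \<in> Z \<Longrightarrow> t \<bullet> z = 0"
    and "Real_Vector_Spaces.dim Z + 1 = DIM('a)"
  shows "\<exists>r. t = r *\<^sub>R s"
proof -
  define u where "u = t - ((t \<bullet> s) / (s \<bullet> s)) *\<^sub>R s"
  have "s \<notin> Real_Vector_Spaces.span Z"
  proof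
    assume "s \<in> Real_Vector_Spaces.span Z"
    moreover have "Real_Vector_Spaces.span Z \<subseteq> {x. s \<bullet> x = 0}"
      using assms(2) by (intro real_vector.span_minimal subspace_hyperplane) auto
    ultimately show False using assms(1) by auto
  qed
  then have "Real_Vector_Spaces.dim (insert s Z) = DIM('a)"
    using assms(4) by (simp add: dim_insert)
  then have "Real_Vector_Spaces.span (insert s Z) = UNIV" by (simp add: dim_eq_full)
  moreover have "insert s Z \<subseteq> {x. u \<bullet> x = 0}"
    using assms(1-3) by (auto simp: u_def inner_diff_left)
  then have "Real_Vector_Spaces.span (insert s Z) \<subseteq> {x. u \<bullet> x = 0}"
    by (rule real_vector.span_minimal) (rule subspace_hyperplane)
  ultimately have "u \<bullet> u = 0" by blast
  then have "u = 0" by simp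
  then show ?thesis by (auto simp: u_def)
qed

text \<open>Real coefficients on the negated face are absorbed by adding a sufficiently large
  lattice point \<open>p\<close> of \<open>F\<close>. Then \<open>p - a\<close> is a lattice point
  of the real cone, and saturation puts it into \<open>Q\<close>.\<close>

lemma cone_diff_face_lattice_point:
  fixes Q :: "(int ^ 'd) set"
  assumes Q: "is_submonoid Q" "saturated Q"
    and F: "is_submonoid F" "F \<subseteq> Q"
    and x: "x \<in> convex_cone hull (real_vec ` Q)" and y: "y \<in> convex_cone hull (uminus ` real_vec ` F)"
    and a: "real_vec (- a) = x + y"
  shows "\<exists>q\<in>Q. \<exists>p\<in>F. a = p - q"
proof -
  let ?C = "convex_cone hull (real_vec ` Q)"
  \<comment> \<open>The vectors that some lattice point of \<open>F\<close> moves into the cone.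
    They form a convex cone containing \<open>- F\<close>, hence its convex cone hull, and in
    particular \<open>y\<close>.\<close>
  let ?Y = "{y. \<exists>p\<in>F. real_vec p + y \<in> ?C}"
  have mult: "\<exists>p'\<in>F. real_vec p' = of_nat n *\<^sub>R real_vec p" if "p \<in> F" for p n
  proof (induction n)
    case 0
    then show ?case using F(1) by (auto simp: is_submonoid_def intro!: bexI[of _ 0])
  next
    case (Suc n)
    then obtain p' where "p' \<in> F" "real_vec p' = of_nat n *\<^sub>R real_vec p" by blast
    then show ?case using F(1) that
      by (intro bexI[of _ "p + p'"]) (auto simp: is_submonoid_def real_vec_add scaleR_add_left)
  qed
  have inC: "real_vec p \<in> ?C" if "p \<in> F" for p using that F(2) by (blast intro: hull_inc)
  have "0 \<in> ?Y"
    using F(1) convex_cone_hull_contains_0 by (auto simp: is_submonoid_def intro!: bexI[of _ 0])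
  moreover have "y + z \<in> ?Y" if "y \<in> ?Y" "z \<in> ?Y" for y z
  proof -
    obtain p p' where p: "p \<in> F" "real_vec p + y \<in> ?C" "p' \<in> F" "real_vec p' + z \<in> ?C"
      using \<open>y \<in> ?Y\<close> \<open>z \<in> ?Y\<close> by blast
    then have "(real_vec p + y) + (real_vec p' + z) \<in> ?C" using p by (blast intro: convex_cone_hull_add)
    moreover have "(real_vec p + y) + (real_vec p' + z) = real_vec (p + p') + (y + z)"
      by (simp add: real_vec_add)
    moreover have "p + p' \<in> F" using p F(1) by (simp add: is_submonoid_def)
    ultimately show ?thesis by auto
  qed
  moreover have "c *\<^sub>R y \<in> ?Y" if "y \<in> ?Y" and c: "c \<ge> 0" for y and c :: real
  proof -
    obtain p where p: "p \<in> F" "real_vec p + y \<in> ?C" using \<open>y \<in> ?Y\<close> by blast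
    \<comment> \<open>Rounding \<open>c\<close> up to \<open>n\<close> makes the coefficient of
      \<open>p\<close> integral at the cost of \<open>n - c\<close> times \<open>real_vec p\<close>,
      which stays in the cone since \<open>F\<close> is contained in \<open>Q\<close>.\<close>
    obtain n :: nat where n: "c \<le> n" using real_arch_simple by blast
    obtain p' where p': "p' \<in> F" "real_vec p' = of_nat n *\<^sub>R real_vec p" using mult[OF p(1)] by blast
    have "c *\<^sub>R (real_vec p + y) + (of_nat n - c) *\<^sub>R real_vec p \<in> ?C"
      using convex_cone_hull_add[OF convex_cone_hull_mul[OF p(2) c] convex_cone_hull_mul[OF inC[OF p(1)]]] n
      by simp
    moreover have "c *\<^sub>R (real_vec p + y) + (of_nat n - c) *\<^sub>R real_vec p = real_vec p' + c *\<^sub>R y"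
      by (simp add: p' algebra_simps)
    ultimately show ?thesis using p'(1) by auto
  qed
  ultimately have "convex_cone ?Y" unfolding convex_cone_iff by blast
  moreover have "uminus ` real_vec ` F \<subseteq> ?Y"
    using convex_cone_hull_contains_0 by force
  ultimately have "convex_cone hull (uminus ` real_vec ` F) \<subseteq> ?Y" by (intro hull_minimal)
  then have "y \<in> ?Y" using y by (rule subsetD)
  then obtain p where p: "p \<in> F" "real_vec p + y \<in> ?C" by (elim CollectE bexE)
  have "real_vec (p - a) = real_vec p + real_vec (- a)" by (simp add: real_vec_diff real_vec_minus)
  also have "\<dots> = x + (real_vec p + y)" unfolding a by simp
  finally have "real_vec (p - a) = x + (real_vec p + y)" .
  then have "real_vec (p - a) \<in> ?C" using x p(2) by (simp add: convex_cone_hull_add)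
  then have "p - a \<in> Q" using Q(2)[unfolded saturated_def] by (metis mem_Collect_eq)
  then show ?thesis using p(1) by (intro bexI[of _ "p - a"] bexI[of _ p]) auto
qed

text \<open>A Farkas argument. The cone generated by \<open>A\<close> and the negatives of the
  generators in \<open>F\<close> is closed because it is finitely generated, and it misses
  \<open>- a\<close> by the preceding lattice argument. A separating functional is then rotated
  until its zeros among the generators span a hyperplane.\<close>

lemma face_separating_normal:
  fixes Q :: "(int ^ 'd) set"
  assumes A: "finite A" "Q = is_submonoid hull A"
    and "saturated Q" "group_closure Q = UNIV" "face Q F"
    and a: "\<not> (\<exists>q\<in>Q. \<exists>p\<in>F. a = p - q)"
  obtains s where "s \<bullet> real_vec a > 0" "\<And>q. q \<in> Q \<Longrightarrow> s \<bullet> real_vec q \<ge> 0"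
    "\<And>q. q \<in> F \<Longrightarrow> s \<bullet> real_vec q = 0"
    "Real_Vector_Spaces.dim (real_vec ` {g \<in> A. s \<bullet> real_vec g = 0}) + 1 = CARD('d)"
proof -
  have Q: "is_submonoid Q" using A(2) by (simp add: is_submonoid_hull)
  obtain f :: "real ^ 'd \<Rightarrow> real" where f: "linear f" "\<And>q. q \<in> Q \<Longrightarrow> f (real_vec q) \<ge> 0"
      "F = {q \<in> Q. f (real_vec q) = 0}"
    using face_eq_zeros[OF Q assms(5)] by blast
  have F: "is_submonoid F"
    using Q f(1) by (auto simp: f(3) is_submonoid_def linear_0 linear_add real_vec_add)
  have AQ: "A \<subseteq> Q" using A(2) by (simp add: hull_subset)
  let ?G = "real_vec ` A \<union> uminus ` real_vec ` (A \<inter> F)"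
  have "real_vec (- a) \<notin> convex_cone hull ?G"
  proof
    assume "real_vec (- a) \<in> convex_cone hull ?G"
    then obtain x y where xy: "x \<in> convex_cone hull (real_vec ` A)"
        "y \<in> convex_cone hull (uminus ` real_vec ` (A \<inter> F))" "real_vec (- a) = x + y"
      unfolding convex_cone_hull_Un by blast
    have "x \<in> convex_cone hull (real_vec ` Q)"
      using xy(1) hull_mono[of "real_vec ` A" "real_vec ` Q" convex_cone] AQ by blast
    moreover have "y \<in> convex_cone hull (uminus ` real_vec ` F)"
      using xy(2) hull_mono[of "uminus ` real_vec ` (A \<inter> F)" "uminus ` real_vec ` F" convex_cone] by blast
    ultimately show False
      using cone_diff_face_lattice_point[OF Q assms(3) F _ _ _ xy(3)] a f(3) by blast
  qed
  moreover have "closed (convex_cone hull ?G)" using A(1) by (intro closed_convex_cone_hull) auto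
  ultimately obtain t b where tb: "t \<bullet> real_vec (- a) < b" "\<forall>x\<in>convex_cone hull ?G. b < t \<bullet> x"
    using separating_hyperplane_closed_point[OF convex_convex_cone_hull] by blast
  have b0: "b < 0" using tb(2) convex_cone_hull_contains_0 by force
  have nonneg: "t \<bullet> x \<ge> 0" if x: "x \<in> ?G" for x
  proof (rule ccontr)
    assume "\<not> t \<bullet> x \<ge> 0"
    then have neg: "t \<bullet> x < 0" by simp
    \<comment> \<open>A negative value could be rescaled, inside the cone, to be exactly
      \<open>b\<close>, against strict separation.\<close>
    then have "(b / (t \<bullet> x)) *\<^sub>R x \<in> convex_cone hull ?G"
      using b0 x by (intro convex_cone_hull_mul hull_inc) (auto simp: divide_nonpos_neg)
    then have "b < t \<bullet> ((b / (t \<bullet> x)) *\<^sub>R x)" using tb(2) by blast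
    then show False using neg by simp
  qed
  have ta: "t \<bullet> real_vec a > 0" using tb(1) b0 by (simp add: real_vec_minus)
  have span: "Real_Vector_Spaces.span (real_vec ` A) = UNIV"
    using span_real_vec_generators assms(4) A(2) by blast
  obtain s where s: "s \<bullet> real_vec a > 0" "\<forall>g\<in>real_vec ` A. s \<bullet> g \<ge> 0"
      "\<forall>g\<in>real_vec ` A. t \<bullet> g = 0 \<longrightarrow> s \<bullet> g = 0"
      "Real_Vector_Spaces.dim {g \<in> real_vec ` A. s \<bullet> g = 0} + 1 = DIM(real ^ 'd)"
    using separating_functional_max_zeros[OF finite_imageI[OF A(1)] span ta] nonneg by blast
  \<comment> \<open>The two sign conditions pass from generators to all of \<open>Q\<close> because
    they cut out a submonoid: \<open>f\<close> is nonnegative, so \<open>f\<close> vanishes on a sum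
    only if it vanishes on both terms.\<close>
  let ?P = "\<lambda>q. q \<in> Q \<and> s \<bullet> real_vec q \<ge> 0 \<and> (f (real_vec q) = 0 \<longrightarrow> s \<bullet> real_vec q = 0)"
  have gen: "?P g" if "g \<in> A" for g
  proof -
    \<comment> \<open>A generator in \<open>F\<close> enters the cone with both signs, which forces
      the value 0; the rotation preserves these zeros.\<close>
    have "t \<bullet> real_vec g = 0" if "f (real_vec g) = 0"
      using nonneg[of "real_vec g"] nonneg[of "- real_vec g"] \<open>g \<in> A\<close> that AQ f(3) by auto
    then show ?thesis using that s AQ by auto
  qed
  have "is_submonoid {q. ?P q}"
    using Q f(1,2)
    by (auto simp: is_submonoid_def real_vec_add linear_add linear_0 inner_add_right add_nonneg_eq_0_iff)
  then have nn: "?P q" if "q \<in> Q" for q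
    using hull_minimal[of A "{q. ?P q}" is_submonoid] gen that A(2) by blast
  have "{g \<in> real_vec ` A. s \<bullet> g = 0} = real_vec ` {g \<in> A. s \<bullet> real_vec g = 0}" by auto
  then show thesis using that[of s] s nn f(3) by auto
qed

text \<open>Finitely many normals suffice because a hyperplane spanned by generators of \<open>Q\<close> has only one
  normal direction, and the generators have finitely many subsets.\<close>

lemma face_diff_halfspaces:
  fixes Q :: "(int ^ 'd) set"
  assumes "affine_semigroup Q" "saturated Q" "group_closure Q = UNIV" "face Q F"
  obtains K where "finite K" "\<And>t. t \<in> K \<Longrightarrow> facet_normal Q t"
    "\<And>a. (\<exists>q\<in>Q. \<exists>p\<in>F. a = p - q) \<longleftrightarrow> (\<forall>t\<in>K. int_pairing t a \<le> 0)"
proof -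
  obtain A where A: "finite A" "Q = is_submonoid hull A"
    using assms(1) by (auto simp: affine_semigroup_def)
  have Q: "is_submonoid Q" using A(2) by (simp add: is_submonoid_hull)
  have AQ: "A \<subseteq> Q" using A(2) by (simp add: hull_subset)
  have FQ: "F \<subseteq> Q" using assms(4) by (auto simp: face_def)
  have spanQ: "Real_Vector_Spaces.span (real_vec ` Q) = UNIV"
    using span_real_vec_generators[of A] assms(3) A(2)
      real_vector.span_mono[OF image_mono[OF AQ], of real_vec] by auto
  define hyp where "hyp B \<longleftrightarrow> B \<subseteq> A \<and> Real_Vector_Spaces.dim (real_vec ` B) + 1 = CARD('d)" for B
  define n where "n B = (SOME t. t \<noteq> 0 \<and> (\<forall>b\<in>B. int_pairing t b = 0))" for B :: "(int ^ 'd) set"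
  have n: "n B \<noteq> 0 \<and> (\<forall>b\<in>B. int_pairing (n B) b = 0)" if "hyp B" for B
  proof -
    have "Real_Vector_Spaces.dim (real_vec ` B) < CARD('d)" using that by (simp add: hyp_def)
    then show ?thesis unfolding n_def by (rule integral_normal_exists) (rule someI, blast)
  qed
  \<comment> \<open>Nonnegativity on \<open>Q\<close> and vanishing on \<open>F\<close> give
    \<open>t \<le> 0\<close> on \<open>F - Q\<close>. Both signs of \<open>n B\<close> are offered
    because the choice of a normal leaves its orientation open.\<close>
  define K where "K = {t. (\<exists>B. hyp B \<and> (t = n B \<or> t = - n B)) \<and> (\<forall>q\<in>Q. int_pairing t q \<ge> 0)
    \<and> (\<forall>q\<in>F. int_pairing t q = 0)}"
  have "K \<subseteq> n ` Pow A \<union> uminus ` n ` Pow A" by (auto simp: K_def hyp_def)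
  then have "finite K" by (rule finite_subset) (use A(1) in auto)
  moreover have "facet_normal Q t" if tK: "t \<in> K" for t
  proof -
    obtain B where B: "hyp B" "t = n B \<or> t = - n B" using tK by (auto simp: K_def)
    show ?thesis
    proof (rule facet_zeros_of_normal[OF Q spanQ])
      show "t \<noteq> 0" using B n by auto
      show "int_pairing t q \<ge> 0" if "q \<in> Q" for q using that \<open>t \<in> K\<close> by (auto simp: K_def)
      show "B \<subseteq> Q" using B AQ by (auto simp: hyp_def)
      show "int_pairing t b = 0" if "b \<in> B" for b using that B n by (auto simp: int_pairing_uminus)
      show "Real_Vector_Spaces.dim (real_vec ` B) + 1 = CARD('d)" using B by (simp add: hyp_def)
    qed
  qed
  moreover have "(\<exists>q\<in>Q. \<exists>p\<in>F. a = p - q) \<longleftrightarrow> (\<forall>t\<in>K. int_pairing t a \<le> 0)" for a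
  proof
    assume "\<exists>q\<in>Q. \<exists>p\<in>F. a = p - q"
    then show "\<forall>t\<in>K. int_pairing t a \<le> 0" by (auto simp: K_def int_pairing_diff)
  next
    assume K: "\<forall>t\<in>K. int_pairing t a \<le> 0"
    show "\<exists>q\<in>Q. \<exists>p\<in>F. a = p - q"
    proof (rule ccontr)
      assume "\<not> ?thesis"
      then obtain s where s: "s \<bullet> real_vec a > 0" "\<And>q. q \<in> Q \<Longrightarrow> s \<bullet> real_vec q \<ge> 0"
          "\<And>q. q \<in> F \<Longrightarrow> s \<bullet> real_vec q = 0"
          "Real_Vector_Spaces.dim (real_vec ` {g \<in> A. s \<bullet> real_vec g = 0}) + 1 = CARD('d)"
        by (rule face_separating_normal[OF A assms(2-4)]) blast
      define B where "B = {g \<in> A. s \<bullet> real_vec g = 0}"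
      have B: "hyp B" using s(4) by (auto simp: hyp_def B_def)
      have nB: "n B \<noteq> 0" "\<forall>b\<in>B. int_pairing (n B) b = 0" using n[OF B] by auto
      have "\<exists>r. real_vec (n B) = r *\<^sub>R s"
      proof (rule parallel_if_orthogonal_to_hyperplane)
        show "s \<noteq> 0" using s(1) by auto
        show "s \<bullet> z = 0" if "z \<in> real_vec ` B" for z using that by (auto simp: B_def)
        show "real_vec (n B) \<bullet> z = 0" if "z \<in> real_vec ` B" for z
          using that nB by (auto simp: real_vec_inner)
        show "Real_Vector_Spaces.dim (real_vec ` B) + 1 = DIM(real ^ 'd)" using s(4) by (simp add: B_def)
      qed
      then obtain r where r: "real_vec (n B) = r *\<^sub>R s" by blast
      have r0: "r \<noteq> 0" using r nB(1) by (metis real_vec_eq_0_iff scale_zero_left)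
      \<comment> \<open>The chosen normal may point against \<open>s\<close>. The sign turns it into
        a positive multiple of \<open>s\<close>, which satisfies the conditions of \<open>K\<close>
        and is still positive at \<open>a\<close>.\<close>
      define t where "t = (if r > 0 then n B else - n B)"
      have t: "of_int (int_pairing t q) = \<bar>r\<bar> * (s \<bullet> real_vec q)" for q
        using r0 by (simp add: t_def r real_vec_minus flip: real_vec_inner)
      have "int_pairing t q \<ge> 0" if "q \<in> Q" for q
        using t[of q] s(2)[OF that] by (metis abs_ge_zero mult_nonneg_nonneg of_int_0_le_iff)
      moreover have "int_pairing t q = 0" if "q \<in> F" for q
        using t[of q] s(3)[OF that] by simp
      ultimately have "t \<in> K" using B by (auto simp: K_def t_def)
      then have "int_pairing t a \<le> 0" using K by blast
      moreover have "of_int (int_pairing t a) > (0::real)" using t[of a] s(1) r0 by simp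
      ultimately show False by simp
    qed
  qed
  ultimately show thesis by (rule that)
qed

section \<open>Degree regions of the summands cut out by facet inequalities\<close>

definition halfspace_determined :: "(int ^ 'd) set \<Rightarrow> (int ^ 'd) set \<Rightarrow> bool"
  where "halfspace_determined Q T \<longleftrightarrow> (\<exists>K. finite K \<and> (\<forall>(t, c)\<in>K. facet_normal Q t) \<and>
    T = {a. \<forall>(t, c)\<in>K. int_pairing t a \<le> c})"

lemma mem_shifted_diff: "x \<in> shifted_diff \<alpha> T S \<longleftrightarrow> (\<exists>a\<in>S. \<exists>b\<in>T. x = \<alpha> + (b - a))"
  unfolding shifted_diff_def by blast

lemma halfspace_determined_injective:
  fixes Q :: "(int ^ 'd) set"
  assumes "affine_semigroup Q" "saturated Q" "group_closure Q = UNIV" "face Q F"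
  shows "halfspace_determined Q (shifted_diff \<alpha> F Q)"
proof -
  obtain K where K: "finite K" "\<And>t. t \<in> K \<Longrightarrow> facet_normal Q t"
    "\<And>a. (\<exists>q\<in>Q. \<exists>p\<in>F. a = p - q) \<longleftrightarrow> (\<forall>t\<in>K. int_pairing t a \<le> 0)"
    by (rule face_diff_halfspaces[OF assms]) (rule that)
  have "a \<in> shifted_diff \<alpha> F Q \<longleftrightarrow> (\<exists>q\<in>Q. \<exists>p\<in>F. a - \<alpha> = p - q)" for a
    unfolding mem_shifted_diff by (simp add: diff_eq_eq add.commute)
  then have "shifted_diff \<alpha> F Q = {a. \<forall>(t, c)\<in>(\<lambda>t. (t, int_pairing t \<alpha>)) ` K. int_pairing t a \<le> c}"
    by (auto simp: K(3) int_pairing_diff)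
  then show ?thesis unfolding halfspace_determined_def
    using K(1,2) by (intro exI[of _ "(\<lambda>t. (t, int_pairing t \<alpha>)) ` K"]) auto
qed

text \<open>Reflection \<open>a \<mapsto> \<alpha> - a\<close> carries
  \<open>\<alpha> + Q - F\<close> to \<open>F - Q\<close>, so the normals of the injective case
  serve with reversed sign.\<close>

lemma halfspace_determined_flat:
  fixes Q :: "(int ^ 'd) set"
  assumes "affine_semigroup Q" "saturated Q" "group_closure Q = UNIV" "face Q F"
  shows "halfspace_determined Q (shifted_diff \<alpha> Q F)"
proof -
  obtain K where K: "finite K" "\<And>t. t \<in> K \<Longrightarrow> facet_normal Q t"
    "\<And>a. (\<exists>q\<in>Q. \<exists>p\<in>F. a = p - q) \<longleftrightarrow> (\<forall>t\<in>K. int_pairing t a \<le> 0)"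
    by (rule face_diff_halfspaces[OF assms]) (rule that)
  have "a \<in> shifted_diff \<alpha> Q F \<longleftrightarrow> (\<exists>q\<in>Q. \<exists>p\<in>F. \<alpha> - a = p - q)" for a
  proof -
    have "a = \<alpha> + (q - p) \<longleftrightarrow> \<alpha> - a = p - q" for q p
    proof
      assume "\<alpha> - a = p - q"
      then have "\<alpha> - (\<alpha> - a) = \<alpha> - (p - q)" by simp
      then show "a = \<alpha> + (q - p)" by simp
    qed simp
    then show ?thesis unfolding mem_shifted_diff by blast
  qed
  then have "shifted_diff \<alpha> Q F = {a. \<forall>(t, c)\<in>(\<lambda>t. (- t, - int_pairing t \<alpha>)) ` K. int_pairing t a \<le> c}"
    by (auto simp: K(3) int_pairing_diff int_pairing_uminus)
  then show ?thesis unfolding halfspace_determined_def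
    using K(1,2) by (intro exI[of _ "(\<lambda>t. (- t, - int_pairing t \<alpha>)) ` K"]) (auto intro: facet_normal_minus)
qed

text \<open>The inequalities of all regions together form one finite arrangement, and membership in
  every \<open>T i\<close> is constant on its cells.\<close>

lemma is_sector_pattern_class:
  assumes "finite I" and "\<And>i. i \<in> I \<Longrightarrow> halfspace_determined Q (T i)"
  shows "is_sector Q {b. {i \<in> I. b \<in> T i} = p}"
proof -
  let ?D = "\<lambda>i K. finite K \<and> (\<forall>(t, c)\<in>K. facet_normal Q t) \<and>
      T i = {a. \<forall>(t, c)\<in>K. int_pairing t a \<le> c}"
  have "\<forall>i\<in>I. \<exists>K. ?D i K" using assms(2) unfolding halfspace_determined_def by blast
  then obtain K where K: "\<forall>i\<in>I. ?D i (K i)" by (rule bchoice[THEN exE])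
  show ?thesis
  proof (rule is_sector_if_determined[where K = "\<Union> (K ` I)"])
    show "finite (\<Union> (K ` I))" using assms(1) K by auto
    show "facet_normal Q t" if "(t, c) \<in> \<Union> (K ` I)" for t c using that K by fast
    show "b \<in> {b. {i \<in> I. b \<in> T i} = p}"
      if ab: "\<And>t c. (t, c) \<in> \<Union> (K ` I) \<Longrightarrow> int_pairing t a \<le> c \<longleftrightarrow> int_pairing t b \<le> c"
        and a: "a \<in> {b. {i \<in> I. b \<in> T i} = p}" for a b
    proof -
      have "a \<in> T i \<longleftrightarrow> b \<in> T i" if i: "i \<in> I" for i
      proof -
        have T: "x \<in> T i \<longleftrightarrow> (\<forall>(t, c)\<in>K i. int_pairing t x \<le> c)" for x using K i by blast
        show ?thesis unfolding T using ab i by fast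
      qed
      then show ?thesis using a by blast
    qed
  qed
qed

subsection \<open>Graded modules\<close>

lemma single_in_semigroup_ring: "q \<in> Q \<Longrightarrow> Poly_Mapping.single q c \<in> carrier (semigroup_ring Q)"
  by (simp add: semigroup_ring_def)

lemma field_base_field: "field (base_field :: 'k::field ring)"
proof -
  have "cring (base_field :: 'k ring)"
  proof (rule cringI)
    show "abelian_group (base_field :: 'k ring)"
      by (rule abelian_groupI) (auto simp: base_field_def add.assoc add.commute intro: exI[of _ "- _"])
    show "Group.comm_monoid (base_field :: 'k ring)"
      by (rule comm_monoidI) (auto simp: base_field_def mult.assoc mult.commute)
  qed (auto simp: base_field_def distrib_right)
  then show ?thesis
  proof (rule cring.cring_fieldI2)
    fix a :: 'k assume "a \<noteq> \<zero>\<^bsub>base_field\<^esub>"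
    then show "\<exists>b\<in>carrier base_field. a \<otimes>\<^bsub>base_field\<^esub> b = \<one>\<^bsub>base_field\<^esub>"
      by (intro bexI[of _ "inverse a"]) (auto simp: base_field_def)
  qed (auto simp: base_field_def)
qed

text \<open>Induction on the number of functionals: the kernel of the last one is finite-dimensional
  by the induction hypothesis, and one further vector suffices to span the whole space.\<close>

lemma fin_dim_if_separating_functionals:
  fixes V :: "('k::field, 'v) module" and \<kappa> :: "nat \<Rightarrow> 'v \<Rightarrow> 'k"
  assumes "vectorspace base_field V"
    and "\<And>i v w. \<lbrakk>i < n; v \<in> carrier V; w \<in> carrier V\<rbrakk> \<Longrightarrow> \<kappa> i (v \<oplus>\<^bsub>V\<^esub> w) = \<kappa> i v + \<kappa> i w"
    and "\<And>i c v. \<lbrakk>i < n; v \<in> carrier V\<rbrakk> \<Longrightarrow> \<kappa> i (c \<odot>\<^bsub>V\<^esub> v) = c * \<kappa> i v"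
    and "\<And>v. \<lbrakk>v \<in> carrier V; \<And>i. i < n \<Longrightarrow> \<kappa> i v = 0\<rbrakk> \<Longrightarrow> v = \<zero>\<^bsub>V\<^esub>"
  shows "vectorspace.fin_dim base_field V"
  using assms
proof (induction n arbitrary: V)
  case 0
  interpret V: vectorspace base_field V by (rule 0)
  have "carrier V = {\<zero>\<^bsub>V\<^esub>}" using 0(4) V.zero_closed by auto
  then show ?case unfolding V.fin_dim_def using V.span_empty by (intro exI[of _ "{}"]) auto
next
  case (Suc n)
  interpret V: vectorspace base_field V by (rule Suc.prems(1))
  let ?W = "{v \<in> carrier V. \<kappa> n v = 0}"
  have add: "\<kappa> n (v \<oplus>\<^bsub>V\<^esub> w) = \<kappa> n v + \<kappa> n w" if "v \<in> carrier V" "w \<in> carrier V" for v w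
    using Suc.prems(2) that by simp
  have smult: "\<kappa> n (c \<odot>\<^bsub>V\<^esub> v) = c * \<kappa> n v" if "v \<in> carrier V" for c v
    using Suc.prems(3) that by simp
  have clos: "c \<odot>\<^bsub>V\<^esub> v \<in> carrier V" if "v \<in> carrier V" for c :: 'k and v
    using that by (intro V.smult_closed) (auto simp: base_field_def)
  have "\<kappa> n (\<zero>\<^bsub>V\<^esub> \<oplus>\<^bsub>V\<^esub> \<zero>\<^bsub>V\<^esub>) = \<kappa> n \<zero>\<^bsub>V\<^esub> + \<kappa> n \<zero>\<^bsub>V\<^esub>" by (rule add) auto
  then have "\<kappa> n \<zero>\<^bsub>V\<^esub> + 0 = \<kappa> n \<zero>\<^bsub>V\<^esub> + \<kappa> n \<zero>\<^bsub>V\<^esub>"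
    by (simp only: V.l_zero[OF V.zero_closed] add_0_right)
  then have k0: "\<kappa> n \<zero>\<^bsub>V\<^esub> = 0" by (metis add_left_imp_eq)
  have sub: "submodule base_field ?W V"
    by (rule submodule.intro) (auto simp: add smult k0 clos V.module_axioms)
  have W: "vectorspace base_field (V\<lparr>carrier := ?W\<rparr>)"
    using sub V.subspace_is_vs[of ?W] V.vectorspace_axioms by (simp add: subspace_def)
  have "vectorspace.fin_dim base_field (V\<lparr>carrier := ?W\<rparr>)"
  proof (rule Suc.IH[OF W])
    show "v = \<zero>\<^bsub>V\<lparr>carrier := ?W\<rparr>\<^esub>"
      if "v \<in> carrier (V\<lparr>carrier := ?W\<rparr>)" "\<And>i. i < n \<Longrightarrow> \<kappa> i v = 0" for v
      using that Suc.prems(4)[of v] by (auto simp: less_Suc_eq)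
  qed (use Suc.prems(2,3) in auto)
  then obtain A where A: "finite A" "A \<subseteq> ?W" "module.span base_field (V\<lparr>carrier := ?W\<rparr>) A = ?W"
    unfolding vectorspace.fin_dim_def[OF W] by auto
  have spanA: "V.span A = ?W" using V.span_li_not_depend(1)[OF A(2) sub] A(3) by simp
  \<comment> \<open>If the last functional vanishes identically, the zero vector serves as
    \<open>v0\<close>, so both cases continue in the same way.\<close>
  obtain v0 where v0: "v0 \<in> carrier V" "\<And>v. v \<in> carrier V \<Longrightarrow> \<exists>c. \<kappa> n v = c * \<kappa> n v0"
  proof (cases "\<exists>v0\<in>carrier V. \<kappa> n v0 \<noteq> 0")
    case True
    then obtain v0 where "v0 \<in> carrier V" "\<kappa> n v0 \<noteq> 0" by blast
    moreover have "\<kappa> n v = (\<kappa> n v / \<kappa> n v0) * \<kappa> n v0" for v using calculation by simp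
    ultimately show thesis using that by blast
  next
    case False
    then show thesis using that[of "\<zero>\<^bsub>V\<^esub>"] by auto
  qed
  have A0: "insert v0 A \<subseteq> carrier V" using A(2) v0(1) by auto
  interpret S: submodule base_field "V.span (insert v0 A)" V by (rule V.span_is_submodule[OF A0])
  have "V.span (insert v0 A) = carrier V"
  proof
    show "V.span (insert v0 A) \<subseteq> carrier V" by (rule S.subset)
    show "carrier V \<subseteq> V.span (insert v0 A)"
    proof
      fix v assume v: "v \<in> carrier V"
      obtain c where c: "\<kappa> n v = c * \<kappa> n v0" using v0(2)[OF v] by blast
      define w where "w = v \<oplus>\<^bsub>V\<^esub> (- c) \<odot>\<^bsub>V\<^esub> v0"
      have "w \<in> ?W" using v v0(1) c by (simp add: w_def add smult clos)
      then have "w \<in> V.span (insert v0 A)"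
        using spanA V.span_is_monotone[of A "insert v0 A"] by blast
      moreover have "v0 \<in> V.span (insert v0 A)" using V.in_own_span[OF A0] by blast
      then have "c \<odot>\<^bsub>V\<^esub> v0 \<in> V.span (insert v0 A)" by (intro S.smult_closed) (auto simp: base_field_def)
      ultimately have "w \<oplus>\<^bsub>V\<^esub> c \<odot>\<^bsub>V\<^esub> v0 \<in> V.span (insert v0 A)" by (rule S.m_closed)
      moreover have "w \<oplus>\<^bsub>V\<^esub> c \<odot>\<^bsub>V\<^esub> v0 = v"
      proof -
        have "(- c) \<odot>\<^bsub>V\<^esub> v0 \<oplus>\<^bsub>V\<^esub> c \<odot>\<^bsub>V\<^esub> v0 = (- c \<oplus>\<^bsub>base_field\<^esub> c) \<odot>\<^bsub>V\<^esub> v0"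
          using v0(1) by (intro V.smult_l_distr[symmetric]) (auto simp: base_field_def)
        also have "\<dots> = \<zero>\<^bsub>base_field\<^esub> \<odot>\<^bsub>V\<^esub> v0" by (simp add: base_field_def)
        also have "\<dots> = \<zero>\<^bsub>V\<^esub>" using v0(1) by (rule V.lmult_0)
        finally show ?thesis using v v0(1) by (simp add: w_def V.a_assoc clos)
      qed
      ultimately show "v \<in> V.span (insert v0 A)" by simp
    qed
  qed
  then show ?case unfolding V.fin_dim_def using A(1) A0 by (intro exI[of _ "insert v0 A"]) auto
qed

section \<open>Homogeneous components in graded modules\<close>

locale graded_mod =
  fixes Q :: "(int ^ 'd) set" and M :: "('k::field, 'd, 'm) zd_module" (structure)
  assumes submonoid: "is_submonoid Q" and graded: "is_graded_module Q M"

sublocale graded_mod \<subseteq> module "semigroup_ring Q" M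
  using graded by (simp add: is_graded_module_def)

context graded_mod
begin

lemma zero_mem: "0 \<in> Q"
  using submonoid by (simp add: is_submonoid_def)

lemma additive_subgroup_piece: "additive_subgroup (gpiece M a) M"
  using graded by (simp add: is_graded_module_def)

lemma piece_carrier: "v \<in> gpiece M a \<Longrightarrow> v \<in> carrier M"
  using additive_subgroup.a_subset[OF additive_subgroup_piece] by blast

lemma piece_zero: "\<zero> \<in> gpiece M a"
  by (rule additive_subgroup.zero_closed[OF additive_subgroup_piece])

lemma piece_add: "v \<in> gpiece M a \<Longrightarrow> w \<in> gpiece M a \<Longrightarrow> v \<oplus> w \<in> gpiece M a"
  by (rule additive_subgroup.a_closed[OF additive_subgroup_piece])

lemma piece_neg: "v \<in> gpiece M a \<Longrightarrow> \<ominus> v \<in> gpiece M a"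
  by (rule additive_subgroup.a_inv_closed[OF additive_subgroup_piece])

lemma piece_mult: "v \<in> gpiece M a \<Longrightarrow> q \<in> Q \<Longrightarrow> Poly_Mapping.single q c \<odot> v \<in> gpiece M (a + q)"
  using graded by (simp add: is_graded_module_def)

lemma piece_shift: "v \<in> gpiece M a \<Longrightarrow> b - a \<in> Q \<Longrightarrow> Poly_Mapping.single (b - a) c \<odot> v \<in> gpiece M b"
  using piece_mult[of v a "b - a" c] by simp

lemma piece_scale: "v \<in> gpiece M a \<Longrightarrow> Poly_Mapping.single 0 c \<odot> v \<in> gpiece M a"
  using piece_mult[OF _ zero_mem, of v a c] by simp

lemma single_smult_single:
  assumes "p \<in> Q" "q \<in> Q" "v \<in> carrier M"
  shows "Poly_Mapping.single p c \<odot> (Poly_Mapping.single q e \<odot> v) = Poly_Mapping.single (p + q) (c * e) \<odot> v"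
  using smult_assoc1[OF single_in_semigroup_ring[OF assms(1)] single_in_semigroup_ring[OF assms(2)] assms(3), of c e]
  by (simp add: semigroup_ring_def mult_single)

lemma one_smult: "v \<in> carrier M \<Longrightarrow> 1 \<odot> v = v"
  using smult_one[of v] by (simp add: semigroup_ring_def)

lemma zero_smult: "v \<in> carrier M \<Longrightarrow> 0 \<odot> v = \<zero>"
  using lmult_0[of v] by (simp add: semigroup_ring_def)

lemma single_smult_add:
  "q \<in> Q \<Longrightarrow> v \<in> carrier M \<Longrightarrow> w \<in> carrier M \<Longrightarrow>
    Poly_Mapping.single q c \<odot> (v \<oplus> w) = Poly_Mapping.single q c \<odot> v \<oplus> Poly_Mapping.single q c \<odot> w"
  by (rule smult_r_distr[OF single_in_semigroup_ring])

lemma single_add_smult: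
  "q \<in> Q \<Longrightarrow> v \<in> carrier M \<Longrightarrow>
    Poly_Mapping.single q (b + c) \<odot> v = Poly_Mapping.single q b \<odot> v \<oplus> Poly_Mapping.single q c \<odot> v"
  using smult_l_distr[OF single_in_semigroup_ring single_in_semigroup_ring, of q q v b c]
  by (simp add: semigroup_ring_def single_add)

lemma vectorspace_piece_space: "vectorspace base_field (piece_space M a)"
proof (rule vs_criteria[OF field_base_field])
  show "\<forall>v\<in>carrier (piece_space M a). \<exists>w\<in>carrier (piece_space M a).
      v \<oplus>\<^bsub>piece_space M a\<^esub> w = \<zero>\<^bsub>piece_space M a\<^esub>"
    using piece_neg piece_carrier by (auto simp: piece_space_def intro!: bexI[of _ "\<ominus> _"] r_neg)
qed (use zero_mem in \<open>auto simp: piece_space_def base_field_def piece_zero piece_add piece_carrier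
    piece_scale single_smult_single one_smult single_smult_add single_add_smult a_assoc a_comm a_lcomm\<close>)

text \<open>The homogeneous component of degree \<open>a\<close>. The description is meaningful on
  the carrier, where the decomposition exists and is unique.\<close>

definition hcomp :: "int ^ 'd \<Rightarrow> 'm \<Rightarrow> 'm" where
  "hcomp a v = (THE f. (\<forall>a. f a \<in> gpiece M a) \<and> finite {a. f a \<noteq> \<zero>} \<and> v = finsum M f {a. f a \<noteq> \<zero>}) a"

lemma hcomp_decomposition:
  assumes "v \<in> carrier M"
  shows "hcomp a v \<in> gpiece M a" "finite {a. hcomp a v \<noteq> \<zero>}"
    "v = finsum M (\<lambda>a. hcomp a v) {a. hcomp a v \<noteq> \<zero>}"
proof -
  let ?P = "\<lambda>f. (\<forall>a. f a \<in> gpiece M a) \<and> finite {a. f a \<noteq> \<zero>} \<and> v = finsum M f {a. f a \<noteq> \<zero>}"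
  have "\<exists>!f. ?P f" using graded assms by (simp add: is_graded_module_def)
  then have "?P (THE f. ?P f)" by (rule theI')
  then have "?P (\<lambda>a. hcomp a v)" by (simp add: hcomp_def)
  then show "hcomp a v \<in> gpiece M a" "finite {a. hcomp a v \<noteq> \<zero>}"
    "v = finsum M (\<lambda>a. hcomp a v) {a. hcomp a v \<noteq> \<zero>}" by blast+
qed

text \<open>The index set may exceed the support, so that the decompositions of two elements can be
  compared over a common set.\<close>

lemma hcomp_unique:
  assumes f: "\<And>a. f a \<in> gpiece M a" and A: "finite A" "\<And>a. a \<notin> A \<Longrightarrow> f a = \<zero>" and v: "v = finsum M f A"
  shows "hcomp a v = f a"
proof -
  let ?P = "\<lambda>f. (\<forall>a. f a \<in> gpiece M a) \<and> finite {a. f a \<noteq> \<zero>} \<and> v = finsum M f {a. f a \<noteq> \<zero>}"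
  have fc: "f \<in> X \<rightarrow> carrier M" for X using f piece_carrier by blast
  have sub: "{a. f a \<noteq> \<zero>} \<subseteq> A" using A(2) by blast
  have "finsum M f {a. f a \<noteq> \<zero>} = finsum M f A"
    by (rule add.finprod_mono_neutral_cong_left[OF A(1) sub]) (use fc in auto)
  then have P: "?P f" using f v sub A(1) finite_subset by metis
  have "v \<in> carrier M" unfolding v using fc by (rule finsum_closed)
  then have "\<exists>!f. ?P f" using graded by (simp add: is_graded_module_def)
  then have "(THE f. ?P f) = f" using P by (rule the1_equality[where P = ?P])
  then show ?thesis by (simp add: hcomp_def)
qed

lemma hcomp_piece:
  assumes "v \<in> gpiece M b"
  shows "hcomp a v = (if a = b then v else \<zero>)"
proof (rule hcomp_unique[where A = "{b}"])
  show "v = (\<Oplus>a\<in>{b}. if a = b then v else \<zero>)"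
    using piece_carrier[OF assms] by (subst finsum_insert) auto
qed (use assms piece_zero in auto)

lemma hcomp_carrier: "v \<in> carrier M \<Longrightarrow> hcomp a v \<in> carrier M"
  using hcomp_decomposition(1) piece_carrier by blast

lemma hcomp_add:
  assumes "v \<in> carrier M" "w \<in> carrier M"
  shows "hcomp a (v \<oplus> w) = hcomp a v \<oplus> hcomp a w"
proof (rule hcomp_unique)
  let ?A = "{a. hcomp a v \<noteq> \<zero>}" and ?B = "{a. hcomp a w \<noteq> \<zero>}"
  have fin: "finite (?A \<union> ?B)" using assms hcomp_decomposition(2) by blast
  have c: "(\<lambda>a. hcomp a v) \<in> X \<rightarrow> carrier M" "(\<lambda>a. hcomp a w) \<in> X \<rightarrow> carrier M" for X
    using assms hcomp_carrier by auto
  have v: "v = (\<Oplus>a\<in>?A \<union> ?B. hcomp a v)"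
    by (subst hcomp_decomposition(3)[OF assms(1)])
      (rule add.finprod_mono_neutral_cong_left[OF fin]; use c in auto)
  have w: "w = (\<Oplus>a\<in>?A \<union> ?B. hcomp a w)"
    by (subst hcomp_decomposition(3)[OF assms(2)])
      (rule add.finprod_mono_neutral_cong_left[OF fin]; use c in auto)
  have "(\<Oplus>a\<in>?A \<union> ?B. hcomp a v \<oplus> hcomp a w)
      = (\<Oplus>a\<in>?A \<union> ?B. hcomp a v) \<oplus> (\<Oplus>a\<in>?A \<union> ?B. hcomp a w)"
    by (rule finsum_addf[OF c])
  then show "v \<oplus> w = (\<Oplus>a\<in>?A \<union> ?B. hcomp a v \<oplus> hcomp a w)"
    by (simp only: v[symmetric] w[symmetric])
  show "finite (?A \<union> ?B)" by (rule fin)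
qed (use assms hcomp_decomposition(1) piece_add in auto)

text \<open>Additive statements reduce to homogeneous elements, because every element is the finite
  sum of its components.\<close>

lemma graded_induct [consumes 1, case_names zero piece add]:
  assumes "v \<in> carrier M" "P \<zero>" "\<And>a v. v \<in> gpiece M a \<Longrightarrow> P v"
    and "\<And>v w. \<lbrakk>v \<in> carrier M; w \<in> carrier M; P v; P w\<rbrakk> \<Longrightarrow> P (v \<oplus> w)"
  shows "P v"
proof -
  have "P (\<Oplus>a\<in>A. hcomp a v)" if "finite A" for A
    using that
  proof (induction A)
    case empty
    then show ?case using assms(2) by simp
  next
    case (insert x A)
    have c: "(\<lambda>a. hcomp a v) \<in> X \<rightarrow> carrier M" for X using assms(1) hcomp_carrier by auto
    have "P (hcomp x v \<oplus> (\<Oplus>a\<in>A. hcomp a v))"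
      using hcomp_carrier[OF assms(1)] finsum_closed[OF c] assms(3)[OF hcomp_decomposition(1)[OF assms(1)]] insert.IH
      by (rule assms(4))
    then show ?case using insert.hyps c hcomp_carrier[OF assms(1)] by (subst finsum_insert) auto
  qed
  then show ?thesis using hcomp_decomposition(2,3)[OF assms(1)] by metis
qed

end

lemma graded_homD:
  assumes "f \<in> graded_hom Q M N"
  shows graded_hom_closed: "v \<in> carrier M \<Longrightarrow> f v \<in> carrier N"
    and graded_hom_add: "v \<in> carrier M \<Longrightarrow> w \<in> carrier M \<Longrightarrow> f (v \<oplus>\<^bsub>M\<^esub> w) = f v \<oplus>\<^bsub>N\<^esub> f w"
    and graded_hom_smult: "r \<in> carrier (semigroup_ring Q) \<Longrightarrow> v \<in> carrier M \<Longrightarrow> f (r \<odot>\<^bsub>M\<^esub> v) = r \<odot>\<^bsub>N\<^esub> f v"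
    and graded_hom_piece: "v \<in> gpiece M a \<Longrightarrow> f v \<in> gpiece N a"
  using assms by (auto simp: graded_hom_def module_hom_def image_subset_iff)

lemma graded_hom_zero:
  assumes "graded_mod Q M" "graded_mod Q N" "f \<in> graded_hom Q M N"
  shows "f \<zero>\<^bsub>M\<^esub> = \<zero>\<^bsub>N\<^esub>"
proof -
  interpret M: graded_mod Q M by fact
  interpret N: graded_mod Q N by fact
  have "f \<zero>\<^bsub>M\<^esub> = f (0 \<odot>\<^bsub>M\<^esub> \<zero>\<^bsub>M\<^esub>)" by (simp add: M.zero_smult)
  also have "\<dots> = 0 \<odot>\<^bsub>N\<^esub> f \<zero>\<^bsub>M\<^esub>"
    by (rule graded_hom_smult[OF assms(3)]) (auto simp: semigroup_ring_def)
  also have "\<dots> = \<zero>\<^bsub>N\<^esub>" by (rule N.zero_smult) (rule graded_hom_closed[OF assms(3) M.zero_closed])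
  finally show ?thesis .
qed

lemma graded_hom_hcomp:
  assumes "graded_mod Q M" "graded_mod Q N" "f \<in> graded_hom Q M N" "v \<in> carrier M"
  shows "graded_mod.hcomp N a (f v) = f (graded_mod.hcomp M a v)"
proof -
  interpret M: graded_mod Q M by fact
  interpret N: graded_mod Q N by fact
  have f0: "f \<zero>\<^bsub>M\<^esub> = \<zero>\<^bsub>N\<^esub>" by (rule graded_hom_zero) fact+
  show ?thesis using assms(4)
  proof (induction rule: M.graded_induct)
    case zero
    show ?case using M.hcomp_piece[OF M.piece_zero, of a a] N.hcomp_piece[OF N.piece_zero, of a a] f0
      by simp
  next
    case (piece b v)
    then show ?case using M.hcomp_piece[of v b a] N.hcomp_piece[of "f v" b a] f0
        graded_hom_piece[OF assms(3)] by simp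
  next
    case (add v w)
    then show ?case using graded_hom_add[OF assms(3)] graded_hom_closed[OF assms(3)]
      by (simp add: M.hcomp_add N.hcomp_add M.hcomp_carrier)
  qed
qed

text \<open>The additive projections \<open>pr\<close> replace uniqueness of homogeneous decompositions in \<open>N\<close>.\<close>

lemma graded_iso_bij_pieces:
  assumes M: "graded_mod Q M" and \<theta>: "\<theta> \<in> graded_iso Q M N"
    and zero: "\<And>x. x \<in> carrier N \<Longrightarrow> 0 \<odot>\<^bsub>N\<^esub> x = \<zero>\<^bsub>N\<^esub>"
    and piece: "\<And>a. gpiece N a \<subseteq> carrier N"
    and pr_add: "\<And>a x y. \<lbrakk>x \<in> carrier N; y \<in> carrier N\<rbrakk> \<Longrightarrow> pr a (x \<oplus>\<^bsub>N\<^esub> y) = pr a x \<oplus>\<^bsub>N\<^esub> pr a y"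
    and pr_piece: "\<And>a b x. x \<in> gpiece N b \<Longrightarrow> pr a x = (if a = b then x else \<zero>\<^bsub>N\<^esub>)"
  shows "bij_betw \<theta> (gpiece M a) (gpiece N a)"
proof -
  interpret M: graded_mod Q M by fact
  have hom: "\<theta> \<in> graded_hom Q M N" and bij: "bij_betw \<theta> (carrier M) (carrier N)"
    using \<theta> by (auto simp: graded_iso_def)
  have "\<theta> \<zero>\<^bsub>M\<^esub> = \<theta> (0 \<odot>\<^bsub>M\<^esub> \<zero>\<^bsub>M\<^esub>)" by (simp add: M.zero_smult)
  also have "\<dots> = 0 \<odot>\<^bsub>N\<^esub> \<theta> \<zero>\<^bsub>M\<^esub>"
    by (rule graded_hom_smult[OF hom]) (auto simp: semigroup_ring_def)
  also have "\<dots> = \<zero>\<^bsub>N\<^esub>" by (rule zero) (rule graded_hom_closed[OF hom M.zero_closed])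
  finally have \<theta>0: "\<theta> \<zero>\<^bsub>M\<^esub> = \<zero>\<^bsub>N\<^esub>" .
  have pr: "\<theta> (M.hcomp a v) = pr a (\<theta> v)" if "v \<in> carrier M" for v
    using that
  proof (induction rule: M.graded_induct)
    case zero
    show ?case using pr_piece[OF graded_hom_piece[OF hom M.piece_zero], of a a]
      M.hcomp_piece[OF M.piece_zero, of a a] by simp
  next
    case (piece b v)
    then show ?case using pr_piece[OF graded_hom_piece[OF hom piece], of a] M.hcomp_piece[of v b a] \<theta>0 by simp
  next
    case (add v w)
    then show ?case using graded_hom_add[OF hom] graded_hom_closed[OF hom]
      by (simp add: M.hcomp_add pr_add M.hcomp_carrier)
  qed
  \<comment> \<open>A preimage of \<open>w\<close> need not be visibly homogeneous, but its
    component of degree \<open>a\<close> already maps to \<open>w\<close>.\<close>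
  have "w \<in> \<theta> ` gpiece M a" if w: "w \<in> gpiece N a" for w
  proof -
    obtain v where v: "v \<in> carrier M" "w = \<theta> v"
      using bij w piece[of a] unfolding bij_betw_def by blast
    have "\<theta> (M.hcomp a v) = w" using pr[OF v(1)] pr_piece[OF w, of a] v(2) by simp
    then show ?thesis using M.hcomp_decomposition(1)[OF v(1), of a] by blast
  qed
  moreover have "\<theta> ` gpiece M a \<subseteq> gpiece N a" using graded_hom_piece[OF hom] by blast
  moreover have "inj_on \<theta> (gpiece M a)"
    using bij M.piece_carrier unfolding bij_betw_def by (meson inj_on_subset subsetI)
  ultimately show ?thesis unfolding bij_betw_def by blast
qed

text \<open>Well-definedness of the induced map on cosets when \<open>f\<close> is additive only on
  a subgroup \<open>U\<close>: two representatives in \<open>U\<close> differ by an element of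
  \<open>B\<close> that lies in \<open>U\<close>. For transport \<open>U\<close> is a graded piece,
  for scalars and components it is the whole carrier.\<close>

lemma coset_map_eq:
  assumes B: "abelian_subgroup B G" and U: "additive_subgroup U G"
    and f: "\<And>x. x \<in> U \<Longrightarrow> f x \<in> carrier G" "\<And>x y. \<lbrakk>x \<in> U; y \<in> U\<rbrakk> \<Longrightarrow> f (x \<oplus>\<^bsub>G\<^esub> y) = f x \<oplus>\<^bsub>G\<^esub> f y"
      "\<And>x. \<lbrakk>x \<in> B; x \<in> U\<rbrakk> \<Longrightarrow> f x \<in> B"
    and z: "z \<in> U"
  shows "(\<Union>y\<in>(B +>\<^bsub>G\<^esub> z) \<inter> U. B +>\<^bsub>G\<^esub> f y) = B +>\<^bsub>G\<^esub> f z"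
proof -
  interpret B: abelian_subgroup B G by fact
  interpret U: additive_subgroup U G by fact
  have Uc: "x \<in> carrier G" if "x \<in> U" for x using U.a_subset that by blast
  have "B +>\<^bsub>G\<^esub> f y = B +>\<^bsub>G\<^esub> f z" if y: "y \<in> (B +>\<^bsub>G\<^esub> z) \<inter> U" for y
  proof -
    obtain b where b: "b \<in> B" "y = b \<oplus>\<^bsub>G\<^esub> z" using y by (auto simp: a_r_coset_def')
    have bc: "b \<in> carrier G" using b(1) by (rule B.a_Hcarr)
    have "b = y \<oplus>\<^bsub>G\<^esub> (\<ominus>\<^bsub>G\<^esub> z)" using b(2) bc Uc[OF z] by (simp add: B.a_assoc B.r_neg)
    then have bU: "b \<in> U" using y z by simp
    have "f y = f b \<oplus>\<^bsub>G\<^esub> f z" using f(2)[OF bU z] b(2) by simp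
    then have "f y \<in> B +>\<^bsub>G\<^esub> f z" using f(3)[OF b(1) bU] by (auto simp: a_r_coset_def')
    then show ?thesis using B.a_repr_independence'[of "f y" "f z"] f(1)[OF z] by simp
  qed
  moreover have "z \<in> (B +>\<^bsub>G\<^esub> z) \<inter> U" using z B.a_rcos_self[OF Uc[OF z]] by blast
  ultimately show ?thesis by blast
qed

text \<open>\<open>\<sigma> a\<close> is the set of summands of \<open>M\<close> that are nonzero in degree \<open>a\<close>, and \<open>t a b\<close> maps the basis
  vector of a summand in degree \<open>a\<close> to the one in degree \<open>b\<close>, or to \<open>0\<close> if there is none.\<close>

definition transport_system ::
    "(int ^ 'd) set \<Rightarrow> ('k::field, 'd, 'm) zd_module \<Rightarrow> (int ^ 'd \<Rightarrow> nat set) \<Rightarrow>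
     (int ^ 'd \<Rightarrow> int ^ 'd \<Rightarrow> 'm \<Rightarrow> 'm) \<Rightarrow> bool"
  where "transport_system Q M \<sigma> t \<longleftrightarrow>
    (\<forall>a b. \<forall>v\<in>gpiece M a. t a b v \<in> gpiece M b) \<and>
    (\<forall>a b. \<forall>v\<in>gpiece M a. \<forall>w\<in>gpiece M a. t a b (v \<oplus>\<^bsub>M\<^esub> w) = t a b v \<oplus>\<^bsub>M\<^esub> t a b w) \<and>
    (\<forall>a b c. \<forall>v\<in>gpiece M a. t a b (Poly_Mapping.single 0 c \<odot>\<^bsub>M\<^esub> v) = Poly_Mapping.single 0 c \<odot>\<^bsub>M\<^esub> t a b v) \<and>
    (\<forall>a b. \<forall>v\<in>gpiece M a. b - a \<in> Q \<longrightarrow> t a b v = Poly_Mapping.single (b - a) 1 \<odot>\<^bsub>M\<^esub> v) \<and>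
    (\<forall>a b c. \<forall>v\<in>gpiece M a. \<sigma> a \<inter> \<sigma> c \<subseteq> \<sigma> b \<longrightarrow> t b c (t a b v) = t a c v)"

lemma transport_systemD:
  assumes "transport_system Q M \<sigma> t" "v \<in> gpiece M a"
  shows transport_piece: "t a b v \<in> gpiece M b"
    and transport_add: "w \<in> gpiece M a \<Longrightarrow> t a b (v \<oplus>\<^bsub>M\<^esub> w) = t a b v \<oplus>\<^bsub>M\<^esub> t a b w"
    and transport_scale: "t a b (Poly_Mapping.single 0 c \<odot>\<^bsub>M\<^esub> v) = Poly_Mapping.single 0 c \<odot>\<^bsub>M\<^esub> t a b v"
    and transport_mult: "b - a \<in> Q \<Longrightarrow> t a b v = Poly_Mapping.single (b - a) 1 \<odot>\<^bsub>M\<^esub> v"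
    and transport_trans: "\<sigma> a \<inter> \<sigma> e \<subseteq> \<sigma> b \<Longrightarrow> t b e (t a b v) = t a e v"
  using assms by (simp_all add: transport_system_def)

lemma transport_self:
  assumes "graded_mod Q M" "transport_system Q M \<sigma> t" "v \<in> gpiece M a"
  shows "t a a v = v"
proof -
  interpret M: graded_mod Q M by fact
  show ?thesis using transport_mult[OF assms(2,3), of a] M.zero_mem M.one_smult M.piece_carrier assms(3) by simp
qed

lemma transport_zero:
  assumes "graded_mod Q M" "transport_system Q M \<sigma> t"
  shows "t a b \<zero>\<^bsub>M\<^esub> = \<zero>\<^bsub>M\<^esub>"
proof -
  interpret M: graded_mod Q M by fact
  have "t a b (Poly_Mapping.single 0 0 \<odot>\<^bsub>M\<^esub> \<zero>\<^bsub>M\<^esub>) = Poly_Mapping.single 0 0 \<odot>\<^bsub>M\<^esub> t a b \<zero>\<^bsub>M\<^esub>"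
    by (rule transport_scale[OF assms(2) M.piece_zero])
  then show ?thesis
    using M.piece_carrier[OF transport_piece[OF assms(2) M.piece_zero, of a b]] by (simp add: M.zero_smult)
qed

text \<open>All summands of \<open>M\<close> present at \<open>a\<close> survive at
  \<open>e\<close>, so \<open>v\<close> and its transport to \<open>b\<close> are both multiples of
  one element \<open>u\<close> of degree \<open>e\<close>. The homomorphism commutes with these
  multiplications, and in \<open>N\<close> the route from \<open>e\<close> through \<open>a\<close>
  to \<open>b\<close> is lossless because \<open>\<tau> a = \<tau> b\<close>.\<close>

lemma transport_commute_below:
  assumes M: "graded_mod Q M" "transport_system Q M \<sigma> t" and N: "graded_mod Q N" "transport_system Q N \<tau> s"
    and f: "f \<in> graded_hom Q M N"
    and eq: "\<tau> a = \<tau> b" and e: "a - e \<in> Q" "b - e \<in> Q" "\<sigma> a \<subseteq> \<sigma> e"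
    and v: "v \<in> gpiece M a"
  shows "f (t a b v) = s a b (f v)"
proof -
  interpret M: graded_mod Q M by fact
  interpret N: graded_mod Q N by fact
  define u where "u = t a e v"
  have u: "u \<in> gpiece M e" unfolding u_def by (rule transport_piece[OF M(2) v])
  have fu: "f u \<in> gpiece N e" by (rule graded_hom_piece[OF f u])
  have mult: "f (t e x u) = s e x (f u)" if "x - e \<in> Q" for x
    using transport_mult[OF M(2) u that] transport_mult[OF N(2) fu that]
      graded_hom_smult[OF f single_in_semigroup_ring[OF that] M.piece_carrier[OF u]] by simp
  have "t e a u = t a a v" unfolding u_def by (rule transport_trans[OF M(2) v]) (use e in auto)
  then have va: "v = t e a u" using transport_self[OF M v] by simp
  have "t e b u = t a b v" unfolding u_def by (rule transport_trans[OF M(2) v]) (use e in auto)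
  then have "f (t a b v) = s e b (f u)" using mult[OF e(2)] by simp
  also have "\<dots> = s a b (s e a (f u))" by (rule transport_trans[OF N(2) fu, symmetric]) (use eq in auto)
  also have "\<dots> = s a b (f v)" using mult[OF e(1)] va by simp
  finally show ?thesis .
qed

text \<open>Both sides have degree \<open>b\<close> and agree after multiplication into degree
  \<open>e\<close>, where the homomorphism commutes. That multiplication is injective on
  \<open>N\<close> because every summand present at \<open>b\<close> survives at \<open>e\<close>:
  transport back is a left inverse.\<close>

lemma transport_commute_above:
  assumes M: "graded_mod Q M" "transport_system Q M \<sigma> t" and N: "graded_mod Q N" "transport_system Q N \<tau> s"
    and f: "f \<in> graded_hom Q M N"
    and eq: "\<sigma> a = \<sigma> b" "\<tau> a = \<tau> b" and e: "e - a \<in> Q" "e - b \<in> Q" "\<tau> a \<subseteq> \<tau> e"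
    and v: "v \<in> gpiece M a"
  shows "f (t a b v) = s a b (f v)"
proof -
  interpret M: graded_mod Q M by fact
  interpret N: graded_mod Q N by fact
  have mult: "f (t x e w) = s x e (f w)" if "e - x \<in> Q" "w \<in> gpiece M x" for x w
    using transport_mult[OF M(2) that(2,1)] transport_mult[OF N(2) graded_hom_piece[OF f that(2)] that(1)]
      graded_hom_smult[OF f single_in_semigroup_ring[OF that(1)] M.piece_carrier[OF that(2)]] by simp
  have fv: "f v \<in> gpiece N a" by (rule graded_hom_piece[OF f v])
  have tv: "t a b v \<in> gpiece M b" by (rule transport_piece[OF M(2) v])
  have inj: "s e b (s b e w) = w" if "w \<in> gpiece N b" for w
    using transport_trans[OF N(2) that, of b e] transport_self[OF N that] e(3) eq(2) by auto
  have "s b e (f (t a b v)) = f (t b e (t a b v))" using mult[OF e(2) tv] by simp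
  also have "t b e (t a b v) = t a e v" by (rule transport_trans[OF M(2) v]) (use eq in auto)
  also have "f (t a e v) = s a e (f v)" by (rule mult[OF e(1) v])
  also have "\<dots> = s b e (s a b (f v))" by (rule transport_trans[OF N(2) fv, symmetric]) (use eq in auto)
  finally have "s e b (s b e (f (t a b v))) = s e b (s b e (s a b (f v)))" by simp
  then show ?thesis
    using inj[OF graded_hom_piece[OF f tv]] inj[OF transport_piece[OF N(2) fv]] by simp
qed

section \<open>Coordinates on graded pieces of sums of monomial modules\<close>

text \<open>\<open>\<kappa> a i v\<close> is the coefficient of the basis monomial of degree
  \<open>a\<close> in summand \<open>i\<close>. The conditions keep what the decomposition says
  degree by degree: the piece of degree \<open>a\<close> is the coordinate space on the indices with
  \<open>a \<in> T i\<close>, and a monomial scales the coordinates and kills those leaving their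
  region.\<close>

definition coordinates ::
    "(int ^ 'd) set \<Rightarrow> ('k::field, 'd, 'm) zd_module \<Rightarrow> nat \<Rightarrow> (nat \<Rightarrow> (int ^ 'd) set) \<Rightarrow>
     (int ^ 'd \<Rightarrow> nat \<Rightarrow> 'm \<Rightarrow> 'k) \<Rightarrow> bool"
  where "coordinates Q M n T \<kappa> \<longleftrightarrow>
    (\<forall>a. \<forall>v\<in>gpiece M a. \<forall>w\<in>gpiece M a. \<forall>i<n. \<kappa> a i (v \<oplus>\<^bsub>M\<^esub> w) = \<kappa> a i v + \<kappa> a i w) \<and>
    (\<forall>a. \<forall>v\<in>gpiece M a. \<forall>q\<in>Q. \<forall>c. \<forall>i<n.
      \<kappa> (a + q) i (Poly_Mapping.single q c \<odot>\<^bsub>M\<^esub> v) = (if a + q \<in> T i then c * \<kappa> a i v else 0)) \<and>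
    (\<forall>a. \<forall>v\<in>gpiece M a. \<forall>i<n. a \<notin> T i \<longrightarrow> \<kappa> a i v = 0) \<and>
    (\<forall>a. \<forall>v\<in>gpiece M a. \<forall>w\<in>gpiece M a. (\<forall>i<n. \<kappa> a i v = \<kappa> a i w) \<longrightarrow> v = w) \<and>
    (\<forall>a k. (\<forall>i<n. a \<notin> T i \<longrightarrow> k i = 0) \<longrightarrow> (\<exists>v\<in>gpiece M a. \<forall>i<n. \<kappa> a i v = k i))"

lemma poly_mapping_single_key:
  assumes "Poly_Mapping.keys v \<subseteq> {b}"
  shows "v = Poly_Mapping.single b (Poly_Mapping.lookup v b)"
proof (rule poly_mapping_eqI)
  fix k
  show "Poly_Mapping.lookup v k = Poly_Mapping.lookup (Poly_Mapping.single b (Poly_Mapping.lookup v b)) k"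
    using assms by (cases "k = b") (auto simp: lookup_single in_keys_iff)
qed

lemma lookup_truncate:
  "Poly_Mapping.lookup (Poly_Mapping.mapp (\<lambda>b c. if b \<in> T then c else 0) p) k
    = (if k \<in> T then Poly_Mapping.lookup p k else 0)"
  by (auto simp: lookup_mapp when_def in_keys_iff)

lemma coordinates_exist:
  fixes M :: "('k::field, 'd::finite, 'm) zd_module"
  assumes "graded_mod Q M"
    and "graded_iso Q M (direct_sum {..<n} (\<lambda>i. monomial_module (T i))) \<noteq> {}"
  shows "\<exists>\<kappa>. coordinates Q M n T \<kappa>"
proof -
  interpret M: graded_mod Q M by fact
  define D :: "('k, 'd, nat \<Rightarrow> (int ^ 'd) \<Rightarrow>\<^sub>0 'k) zd_module"
    where "D = direct_sum {..<n} (\<lambda>i. monomial_module (T i))"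
  have D_carrier: "carrier D = (\<Pi>\<^sub>E i\<in>{..<n}. {v. Poly_Mapping.keys v \<subseteq> T i})"
    and D_zero: "\<zero>\<^bsub>D\<^esub> = (\<lambda>i\<in>{..<n}. 0)"
    and D_add: "x \<oplus>\<^bsub>D\<^esub> y = (\<lambda>i\<in>{..<n}. x i + y i)"
    and D_smult: "r \<odot>\<^bsub>D\<^esub> x = (\<lambda>i\<in>{..<n}. Poly_Mapping.mapp (\<lambda>b c. if b \<in> T i then c else 0) (r * x i))"
    and D_piece: "gpiece D a = (\<Pi>\<^sub>E i\<in>{..<n}. {v. Poly_Mapping.keys v \<subseteq> T i \<inter> {a}})" for x y r a
    by (simp_all add: D_def direct_sum_def monomial_module_def)
  obtain \<theta> where \<theta>: "\<theta> \<in> graded_iso Q M D" using assms(2) by (auto simp: D_def)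
  have hom: "\<theta> \<in> graded_hom Q M D" using \<theta> by (simp add: graded_iso_def)
  have D_entry: "x i = Poly_Mapping.single a (Poly_Mapping.lookup (x i) a)"
      "a \<notin> T i \<Longrightarrow> Poly_Mapping.lookup (x i) a = 0" if "x \<in> gpiece D a" "i < n" for x a i
  proof -
    have *: "Poly_Mapping.keys (x i) \<subseteq> T i \<inter> {a}" using that by (auto simp: D_piece)
    then show "x i = Poly_Mapping.single a (Poly_Mapping.lookup (x i) a)"
      by (intro poly_mapping_single_key) auto
    show "a \<notin> T i \<Longrightarrow> Poly_Mapping.lookup (x i) a = 0" using * by (auto simp: in_keys_iff)
  qed
  have D_ext: "x = y" if "x \<in> gpiece D a" "y \<in> gpiece D a" "\<And>i. i < n \<Longrightarrow> x i = y i" for x y a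
    by (rule PiE_ext[OF that(1,2)[unfolded D_piece]]) (use that(3) in auto)
  define pr where "pr a x = (\<lambda>i\<in>{..<n}. Poly_Mapping.single a (Poly_Mapping.lookup (x i) a))"
    for a and x :: "nat \<Rightarrow> (int ^ 'd) \<Rightarrow>\<^sub>0 'k"
  have bij: "bij_betw \<theta> (gpiece M a) (gpiece D a)" for a
  proof (rule graded_iso_bij_pieces[OF assms(1) \<theta>, where pr = pr])
    show "0 \<odot>\<^bsub>D\<^esub> x = \<zero>\<^bsub>D\<^esub>" for x
      unfolding D_smult D_zero
      by (intro restrict_ext poly_mapping_eqI) (simp add: lookup_truncate)
    show "gpiece D a \<subseteq> carrier D" for a
      unfolding D_piece D_carrier by (rule PiE_mono) auto
    show "pr a (x \<oplus>\<^bsub>D\<^esub> y) = pr a x \<oplus>\<^bsub>D\<^esub> pr a y" for a x y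
      unfolding D_add pr_def by (intro restrict_ext) (simp add: lookup_add single_add)
    show "pr a x = (if a = b then x else \<zero>\<^bsub>D\<^esub>)" if x: "x \<in> gpiece D b" for a b x
    proof (rule ext)
      fix i
      show "pr a x i = (if a = b then x else \<zero>\<^bsub>D\<^esub>) i"
      proof (cases "i < n")
        case True
        have xi: "x i = Poly_Mapping.single b (Poly_Mapping.lookup (x i) b)" by (rule D_entry[OF x True])
        then have "a \<noteq> b \<Longrightarrow> Poly_Mapping.lookup (x i) a = 0" by (metis lookup_single_not_eq)
        then show ?thesis using True xi by (simp add: pr_def D_zero)
      next
        case False
        moreover have "x i = undefined" using x False by (auto simp: D_piece PiE_def extensional_def)
        ultimately show ?thesis by (simp add: pr_def D_zero)
      qed
    qed
  qed
  have \<theta>_piece: "\<theta> v \<in> gpiece D a" if "v \<in> gpiece M a" for v a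
    by (rule graded_hom_piece[OF hom that])
  define \<kappa> where "\<kappa> a i v = Poly_Mapping.lookup (\<theta> v i) a" for a i v
  have "coordinates Q M n T \<kappa>"
    unfolding coordinates_def
  proof (intro conjI allI ballI impI)
    fix a v w i assume v: "v \<in> gpiece M a" and w: "w \<in> gpiece M a" and i: "i < n"
    have "\<theta> (v \<oplus>\<^bsub>M\<^esub> w) = \<theta> v \<oplus>\<^bsub>D\<^esub> \<theta> w"
      using v w M.piece_carrier by (intro graded_hom_add[OF hom]) auto
    then show "\<kappa> a i (v \<oplus>\<^bsub>M\<^esub> w) = \<kappa> a i v + \<kappa> a i w"
      using i by (simp add: \<kappa>_def D_add lookup_add)
  next
    fix a v q c i assume v: "v \<in> gpiece M a" and q: "q \<in> Q" and i: "i < n"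
    have "\<theta> (Poly_Mapping.single q c \<odot>\<^bsub>M\<^esub> v) = Poly_Mapping.single q c \<odot>\<^bsub>D\<^esub> \<theta> v"
      using v q M.piece_carrier by (intro graded_hom_smult[OF hom] single_in_semigroup_ring) auto
    then have "\<kappa> (a + q) i (Poly_Mapping.single q c \<odot>\<^bsub>M\<^esub> v)
        = (if a + q \<in> T i then Poly_Mapping.lookup (Poly_Mapping.single q c * \<theta> v i) (a + q) else 0)"
      using i by (simp add: \<kappa>_def D_smult lookup_truncate)
    moreover have "Poly_Mapping.single q c * \<theta> v i = Poly_Mapping.single (a + q) (c * \<kappa> a i v)"
      by (subst D_entry(1)[OF \<theta>_piece[OF v] i]) (simp add: \<kappa>_def mult_single add.commute)
    ultimately show "\<kappa> (a + q) i (Poly_Mapping.single q c \<odot>\<^bsub>M\<^esub> v) = (if a + q \<in> T i then c * \<kappa> a i v else 0)"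
      by simp
  next
    fix a v i assume "v \<in> gpiece M a" "i < n" "a \<notin> T i"
    then show "\<kappa> a i v = 0" using D_entry(2)[OF \<theta>_piece] by (simp add: \<kappa>_def)
  next
    fix a v w assume v: "v \<in> gpiece M a" and w: "w \<in> gpiece M a" and eq: "\<forall>i<n. \<kappa> a i v = \<kappa> a i w"
    have "\<theta> v i = \<theta> w i" if i: "i < n" for i
      using D_entry(1)[OF \<theta>_piece[OF v] i] D_entry(1)[OF \<theta>_piece[OF w] i] eq i unfolding \<kappa>_def by metis
    then have "\<theta> v = \<theta> w" using D_ext[OF \<theta>_piece[OF v] \<theta>_piece[OF w]] by blast
    then show "v = w" using bij[of a] v w unfolding bij_betw_def inj_on_def by blast
  next
    fix a k assume k: "\<forall>i<n. a \<notin> T i \<longrightarrow> k i = (0 :: 'k)"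
    define x where "x = (\<lambda>i\<in>{..<n}. Poly_Mapping.single a (k i))"
    have "x \<in> gpiece D a" using k by (auto simp: x_def D_piece split: if_splits)
    then obtain v where v: "v \<in> gpiece M a" "\<theta> v = x" using bij[of a] unfolding bij_betw_def by (metis imageE)
    have "\<forall>i<n. \<kappa> a i v = k i" by (simp add: \<kappa>_def v(2) x_def)
    then show "\<exists>v\<in>gpiece M a. \<forall>i<n. \<kappa> a i v = k i" using v(1) by blast
  qed
  then show ?thesis by blast
qed

lemma coordinates_scale:
  assumes "graded_mod Q M" "coordinates Q M n T \<kappa>" "v \<in> gpiece M a" "i < n"
  shows "\<kappa> a i (Poly_Mapping.single 0 c \<odot>\<^bsub>M\<^esub> v) = c * \<kappa> a i v"
proof -
  interpret M: graded_mod Q M by fact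
  have "\<forall>a. \<forall>v\<in>gpiece M a. \<forall>q\<in>Q. \<forall>c. \<forall>i<n.
      \<kappa> (a + q) i (Poly_Mapping.single q c \<odot>\<^bsub>M\<^esub> v) = (if a + q \<in> T i then c * \<kappa> a i v else 0)"
    using assms(2) by (simp add: coordinates_def)
  then have "\<kappa> (a + 0) i (Poly_Mapping.single 0 c \<odot>\<^bsub>M\<^esub> v) = (if a + 0 \<in> T i then c * \<kappa> a i v else 0)"
    using assms(3,4) M.zero_mem by blast
  moreover have "a \<notin> T i \<Longrightarrow> \<kappa> a i v = 0" using assms(2-4) by (simp add: coordinates_def)
  ultimately show ?thesis by (simp split: if_splits)
qed

text \<open>Transport copies the coordinates that are allowed at the target and sets the others to
  0. Coordinates separate elements, so every law is checked on them; the composition law holds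
  because coordinates outside \<open>\<sigma> a\<close> vanish from the start.\<close>

lemma transport_system_exists:
  assumes "graded_mod Q M" and \<kappa>: "coordinates Q M n T \<kappa>"
  shows "\<exists>t. transport_system Q M (\<lambda>a. {i. i < n \<and> a \<in> T i}) t"
proof -
  interpret M: graded_mod Q M by fact
  have \<kappa>_add: "\<kappa> a i (v \<oplus>\<^bsub>M\<^esub> w) = \<kappa> a i v + \<kappa> a i w"
    if "v \<in> gpiece M a" "w \<in> gpiece M a" "i < n" for a i v w
    using \<kappa> that by (simp add: coordinates_def)
  have \<kappa>_mult: "\<kappa> b i (Poly_Mapping.single (b - a) c \<odot>\<^bsub>M\<^esub> v) = (if b \<in> T i then c * \<kappa> a i v else 0)"
    if "v \<in> gpiece M a" "b - a \<in> Q" "i < n" for a b c i v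
  proof -
    have "\<forall>a. \<forall>v\<in>gpiece M a. \<forall>q\<in>Q. \<forall>c. \<forall>i<n.
        \<kappa> (a + q) i (Poly_Mapping.single q c \<odot>\<^bsub>M\<^esub> v) = (if a + q \<in> T i then c * \<kappa> a i v else 0)"
      using \<kappa> by (simp add: coordinates_def)
    then have "\<kappa> (a + (b - a)) i (Poly_Mapping.single (b - a) c \<odot>\<^bsub>M\<^esub> v)
        = (if a + (b - a) \<in> T i then c * \<kappa> a i v else 0)"
      using that by blast
    then show ?thesis by simp
  qed
  have \<kappa>_zero: "\<kappa> a i v = 0" if "v \<in> gpiece M a" "i < n" "a \<notin> T i" for a i v
    using \<kappa> that by (simp add: coordinates_def)
  have \<kappa>_inj: "v = w" if "v \<in> gpiece M a" "w \<in> gpiece M a" "\<And>i. i < n \<Longrightarrow> \<kappa> a i v = \<kappa> a i w" for a v w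
    using \<kappa> that by (simp add: coordinates_def)
  define t where "t a b v = (SOME w. w \<in> gpiece M b \<and> (\<forall>i<n. \<kappa> b i w = (if b \<in> T i then \<kappa> a i v else 0)))"
    for a b v
  have t: "t a b v \<in> gpiece M b \<and> (\<forall>i<n. \<kappa> b i (t a b v) = (if b \<in> T i then \<kappa> a i v else 0))" for a b v
  proof -
    have "\<forall>a k. (\<forall>i<n. a \<notin> T i \<longrightarrow> k i = 0) \<longrightarrow> (\<exists>v\<in>gpiece M a. \<forall>i<n. \<kappa> a i v = k i)"
      using \<kappa> by (simp add: coordinates_def)
    from this[rule_format, of b "\<lambda>i. if b \<in> T i then \<kappa> a i v else 0"]
    have "\<exists>w. w \<in> gpiece M b \<and> (\<forall>i<n. \<kappa> b i w = (if b \<in> T i then \<kappa> a i v else 0))" by auto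
    then show ?thesis unfolding t_def by (rule someI_ex)
  qed
  then have tp: "t a b v \<in> gpiece M b" and \<kappa>t: "i < n \<Longrightarrow> \<kappa> b i (t a b v) = (if b \<in> T i then \<kappa> a i v else 0)"
    for a b i v by auto
  have "transport_system Q M (\<lambda>a. {i. i < n \<and> a \<in> T i}) t"
    unfolding transport_system_def
  proof (intro conjI allI ballI impI)
    show "t a b v \<in> gpiece M b" for a b v by (rule tp)
    show "t a b (v \<oplus>\<^bsub>M\<^esub> w) = t a b v \<oplus>\<^bsub>M\<^esub> t a b w" if "v \<in> gpiece M a" "w \<in> gpiece M a" for a b v w
      by (rule \<kappa>_inj[OF tp M.piece_add[OF tp tp]]) (simp add: \<kappa>t \<kappa>_add[OF that] \<kappa>_add[OF tp tp])
    show "t a b (Poly_Mapping.single 0 c \<odot>\<^bsub>M\<^esub> v) = Poly_Mapping.single 0 c \<odot>\<^bsub>M\<^esub> t a b v"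
      if "v \<in> gpiece M a" for a b c v
      by (rule \<kappa>_inj[OF tp M.piece_scale[OF tp]])
        (simp add: \<kappa>t coordinates_scale[OF assms that] coordinates_scale[OF assms tp])
    show "t a b v = Poly_Mapping.single (b - a) 1 \<odot>\<^bsub>M\<^esub> v" if "v \<in> gpiece M a" "b - a \<in> Q" for a b v
      by (rule \<kappa>_inj[OF tp M.piece_shift[OF that]]) (simp add: \<kappa>t \<kappa>_mult[OF that])
    show "t b c (t a b v) = t a c v"
      if v: "v \<in> gpiece M a" and sub: "{i. i < n \<and> a \<in> T i} \<inter> {i. i < n \<and> c \<in> T i} \<subseteq> {i. i < n \<and> b \<in> T i}"
      for a b c v
    proof (rule \<kappa>_inj[OF tp tp])
      fix i assume i: "i < n"
      show "\<kappa> c i (t b c (t a b v)) = \<kappa> c i (t a c v)"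
        using sub i \<kappa>_zero[OF v i] by (auto simp: \<kappa>t)
    qed
  qed
  then show ?thesis by blast
qed

subsection \<open>Homology of a graded complex\<close>

locale graded_cx =
  fixes Q :: "(int ^ 'd) set"
    and J' :: "('k::field, 'd, 'l) zd_module" and d' :: "'l \<Rightarrow> 'm"
    and J :: "('k, 'd, 'm) zd_module" and d :: "'m \<Rightarrow> 'n"
    and J'' :: "('k, 'd, 'n) zd_module"
  assumes submonoid: "is_submonoid Q" and complex: "graded_complex Q J' d' J d J''"

sublocale graded_cx \<subseteq> src: graded_mod Q J'
  by unfold_locales (use submonoid complex in \<open>auto simp: graded_complex_def\<close>)

sublocale graded_cx \<subseteq> mid: graded_mod Q J
  by unfold_locales (use submonoid complex in \<open>auto simp: graded_complex_def\<close>)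

sublocale graded_cx \<subseteq> tgt: graded_mod Q J''
  by unfold_locales (use submonoid complex in \<open>auto simp: graded_complex_def\<close>)

context graded_cx
begin

abbreviation B :: "'m set" where "B \<equiv> d' ` carrier J'"
abbreviation Z :: "'m set" where "Z \<equiv> a_kernel J J'' d"
abbreviation H :: "('k, 'd, 'm set) zd_module" where "H \<equiv> middle_homology J' d' J d J''"

lemma hom_src: "d' \<in> graded_hom Q J' J" and hom_mid: "d \<in> graded_hom Q J J''"
  and d_d': "v \<in> carrier J' \<Longrightarrow> d (d' v) = \<zero>\<^bsub>J''\<^esub>"
  using complex by (auto simp: graded_complex_def)

lemma mod_hom_src: "mod_hom (semigroup_ring Q) J' J d'"
  using hom_src by unfold_locales (simp add: graded_hom_def)

lemma mod_hom_mid: "mod_hom (semigroup_ring Q) J J'' d"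
  using hom_mid by unfold_locales (simp add: graded_hom_def)

lemma Z_iff: "z \<in> Z \<longleftrightarrow> z \<in> carrier J \<and> d z = \<zero>\<^bsub>J''\<^esub>"
  by (simp add: a_kernel_def')

lemma Z_carrier: "z \<in> Z \<Longrightarrow> z \<in> carrier J"
  by (simp add: Z_iff)

lemma Z_submodule: "submodule (semigroup_ring Q) Z J"
proof -
  interpret h: mod_hom "semigroup_ring Q" J J'' d by (rule mod_hom_mid)
  show ?thesis using h.ker_is_submodule by (simp add: h.ker_def a_kernel_def')
qed

lemma B_submodule: "submodule (semigroup_ring Q) B J"
proof -
  interpret h: mod_hom "semigroup_ring Q" J' J d' by (rule mod_hom_src)
  show ?thesis using h.im_is_submodule by (simp add: h.im_def)
qed

lemma B_subset_Z: "B \<subseteq> Z"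
  using d_d' graded_hom_closed[OF hom_src] by (auto simp: Z_iff)

lemma submodule_neg:
  assumes "submodule (semigroup_ring Q) N J" "v \<in> N"
  shows "\<ominus>\<^bsub>J\<^esub> v \<in> N"
proof -
  interpret N: submodule "semigroup_ring Q" N J by fact
  have "\<ominus>\<^bsub>semigroup_ring Q\<^esub> \<one>\<^bsub>semigroup_ring Q\<^esub> \<odot>\<^bsub>J\<^esub> v \<in> N"
    using assms(2) by (intro N.smult_closed) auto
  moreover have "v \<in> carrier J" using assms(2) N.subset by blast
  ultimately show ?thesis by (simp add: mid.smult_minus_1)
qed

lemma B_subgroup: "abelian_subgroup B J"
proof -
  interpret N: submodule "semigroup_ring Q" B J by (rule B_submodule)
  have "subgroup B (add_monoid J)"
  proof (rule mid.add.subgroupI)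
    show "\<ominus>\<^bsub>J\<^esub> a \<in> B" if "a \<in> B" for a
      by (rule submodule_neg[OF B_submodule that])
  qed (use N.subset N.zero_closed N.m_closed in auto)
  then show ?thesis by (intro abelian_subgroupI3 mid.abelian_group_axioms) (simp add: additive_subgroup_def)
qed

text \<open>The component of degree \<open>a\<close> of an arbitrary preimage is again a preimage,
  since \<open>d'\<close> commutes with taking components.\<close>

lemma B_piece:
  assumes "v \<in> B" "v \<in> gpiece J a"
  shows "\<exists>u\<in>gpiece J' a. v = d' u"
proof -
  obtain u where u: "u \<in> carrier J'" "v = d' u" using assms(1) by blast
  have "v = mid.hcomp a v" using mid.hcomp_piece[OF assms(2), of a] by simp
  also have "\<dots> = d' (src.hcomp a u)"
    using graded_hom_hcomp[OF src.graded_mod_axioms mid.graded_mod_axioms hom_src u(1)] u(2) by simp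
  finally show ?thesis using src.hcomp_decomposition(1)[OF u(1)] by blast
qed

lemma H_carrier: "carrier H = (\<lambda>z. B +>\<^bsub>J\<^esub> z) ` Z"
  and H_zero: "\<zero>\<^bsub>H\<^esub> = B"
  and H_piece: "gpiece H a = (\<lambda>z. B +>\<^bsub>J\<^esub> z) ` (Z \<inter> gpiece J a)"
  by (simp_all add: middle_homology_def Let_def)

lemma H_add:
  "x \<in> carrier J \<Longrightarrow> y \<in> carrier J \<Longrightarrow> (B +>\<^bsub>J\<^esub> x) \<oplus>\<^bsub>H\<^esub> (B +>\<^bsub>J\<^esub> y) = B +>\<^bsub>J\<^esub> (x \<oplus>\<^bsub>J\<^esub> y)"
  using abelian_subgroup.a_rcos_sum[OF B_subgroup, of x y] by (simp add: middle_homology_def Let_def)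

lemma coset_map_carrier:
  assumes "\<And>x. x \<in> carrier J \<Longrightarrow> f x \<in> carrier J"
    "\<And>x y. \<lbrakk>x \<in> carrier J; y \<in> carrier J\<rbrakk> \<Longrightarrow> f (x \<oplus>\<^bsub>J\<^esub> y) = f x \<oplus>\<^bsub>J\<^esub> f y"
    "\<And>x. x \<in> B \<Longrightarrow> f x \<in> B" and z: "z \<in> carrier J"
  shows "(\<Union>y\<in>B +>\<^bsub>J\<^esub> z. B +>\<^bsub>J\<^esub> f y) = B +>\<^bsub>J\<^esub> f z"
proof -
  have "B \<subseteq> carrier J" using B_subset_Z Z_carrier by blast
  then have "(B +>\<^bsub>J\<^esub> z) \<inter> carrier J = B +>\<^bsub>J\<^esub> z"
    using z by (auto simp: a_r_coset_def')
  moreover have "additive_subgroup (carrier J) J"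
    by (simp add: additive_subgroup_def mid.add.subgroup_self)
  ultimately show ?thesis using coset_map_eq[OF B_subgroup, of "carrier J" f z] assms by simp
qed

lemma H_smult:
  assumes "r \<in> carrier (semigroup_ring Q)" "x \<in> carrier J"
  shows "r \<odot>\<^bsub>H\<^esub> (B +>\<^bsub>J\<^esub> x) = B +>\<^bsub>J\<^esub> (r \<odot>\<^bsub>J\<^esub> x)"
proof -
  interpret N: submodule "semigroup_ring Q" B J by (rule B_submodule)
  have "(\<Union>y\<in>B +>\<^bsub>J\<^esub> x. B +>\<^bsub>J\<^esub> (r \<odot>\<^bsub>J\<^esub> y)) = B +>\<^bsub>J\<^esub> (r \<odot>\<^bsub>J\<^esub> x)"
    using assms by (intro coset_map_carrier mid.smult_closed mid.smult_r_distr N.smult_closed)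
  then show ?thesis by (simp add: middle_homology_def Let_def)
qed

lemma H_coset_zero: "z \<in> B \<Longrightarrow> B +>\<^bsub>J\<^esub> z = \<zero>\<^bsub>H\<^esub>"
  using abelian_subgroup.a_rcos_const[OF B_subgroup] by (simp add: H_zero)

lemma H_zero_smult: "C \<in> carrier H \<Longrightarrow> 0 \<odot>\<^bsub>H\<^esub> C = \<zero>\<^bsub>H\<^esub>"
proof -
  assume "C \<in> carrier H"
  then obtain z where z: "z \<in> Z" "C = B +>\<^bsub>J\<^esub> z" by (auto simp: H_carrier)
  interpret N: submodule "semigroup_ring Q" B J by (rule B_submodule)
  have "0 \<odot>\<^bsub>H\<^esub> C = B +>\<^bsub>J\<^esub> (0 \<odot>\<^bsub>J\<^esub> z)"
    unfolding z(2) by (rule H_smult) (use z Z_carrier in \<open>auto simp: semigroup_ring_def\<close>)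
  then show ?thesis using z(1) Z_carrier N.zero_closed by (simp add: mid.zero_smult H_coset_zero)
qed

lemma piece_H_carrier: "gpiece H a \<subseteq> carrier H"
  by (auto simp: H_piece H_carrier)

lemma Z_add: "x \<in> Z \<Longrightarrow> y \<in> Z \<Longrightarrow> x \<oplus>\<^bsub>J\<^esub> y \<in> Z"
  and Z_zero: "\<zero>\<^bsub>J\<^esub> \<in> Z"
  and Z_smult: "r \<in> carrier (semigroup_ring Q) \<Longrightarrow> x \<in> Z \<Longrightarrow> r \<odot>\<^bsub>J\<^esub> x \<in> Z"
proof -
  interpret N: submodule "semigroup_ring Q" Z J by (rule Z_submodule)
  show "x \<in> Z \<Longrightarrow> y \<in> Z \<Longrightarrow> x \<oplus>\<^bsub>J\<^esub> y \<in> Z" by (rule N.m_closed)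
  show "\<zero>\<^bsub>J\<^esub> \<in> Z" by (rule N.zero_closed)
  show "r \<in> carrier (semigroup_ring Q) \<Longrightarrow> x \<in> Z \<Longrightarrow> r \<odot>\<^bsub>J\<^esub> x \<in> Z" by (rule N.smult_closed)
qed

lemma B_smult: "r \<in> carrier (semigroup_ring Q) \<Longrightarrow> x \<in> B \<Longrightarrow> r \<odot>\<^bsub>J\<^esub> x \<in> B"
  by (rule submodule.smult_closed[OF B_submodule])

text \<open>The projections needed on homology are induced by \<open>mid.hcomp\<close>. They are
  well defined on cosets because the components of a boundary are boundaries.\<close>

lemma graded_iso_homology_bij_pieces:
  assumes "graded_mod Q G" "\<theta> \<in> graded_iso Q G H"
  shows "bij_betw \<theta> (gpiece G a) (gpiece H a)"
proof -
  define pr where "pr a C = (\<Union>z\<in>C. B +>\<^bsub>J\<^esub> mid.hcomp a z)" for a C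
  have hB: "mid.hcomp a x \<in> B" if "x \<in> B" for a x
  proof -
    obtain u where u: "u \<in> carrier J'" "x = d' u" using \<open>x \<in> B\<close> by blast
    then show ?thesis
      using graded_hom_hcomp[OF src.graded_mod_axioms mid.graded_mod_axioms hom_src u(1)] src.hcomp_carrier[OF u(1)]
      by auto
  qed
  have pr: "pr a (B +>\<^bsub>J\<^esub> z) = B +>\<^bsub>J\<^esub> mid.hcomp a z" if "z \<in> carrier J" for a z
    unfolding pr_def using mid.hcomp_carrier mid.hcomp_add hB that by (rule coset_map_carrier)
  show ?thesis
  proof (rule graded_iso_bij_pieces[OF assms H_zero_smult piece_H_carrier, where pr = pr])
    fix a x y assume "x \<in> carrier H" "y \<in> carrier H"
    then obtain z w where "z \<in> carrier J" "w \<in> carrier J" "x = B +>\<^bsub>J\<^esub> z" "y = B +>\<^bsub>J\<^esub> w"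
      using Z_carrier by (auto simp: H_carrier)
    then show "pr a (x \<oplus>\<^bsub>H\<^esub> y) = pr a x \<oplus>\<^bsub>H\<^esub> pr a y"
      by (simp add: pr H_add mid.hcomp_add mid.hcomp_carrier)
  next
    fix a b x assume "x \<in> gpiece H b"
    then obtain z where z: "z \<in> Z" "z \<in> gpiece J b" "x = B +>\<^bsub>J\<^esub> z" by (auto simp: H_piece)
    have "\<zero>\<^bsub>J\<^esub> \<in> B" by (rule submodule.zero_closed[OF B_submodule])
    then show "pr a x = (if a = b then x else \<zero>\<^bsub>H\<^esub>)"
      using z Z_carrier[OF z(1)] by (simp add: pr mid.hcomp_piece[OF z(2)] H_coset_zero)
  qed
qed

lemma H_scale:
  "x \<in> carrier J \<Longrightarrow> Poly_Mapping.single 0 c \<odot>\<^bsub>H\<^esub> (B +>\<^bsub>J\<^esub> x) = B +>\<^bsub>J\<^esub> (Poly_Mapping.single 0 c \<odot>\<^bsub>J\<^esub> x)"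
  by (rule H_smult[OF single_in_semigroup_ring[OF mid.zero_mem]])

lemma vectorspace_cycles:
  "vectorspace base_field ((piece_space J a)\<lparr>carrier := Z \<inter> gpiece J a\<rparr>)"
proof -
  interpret V: vectorspace base_field "piece_space J a" by (rule mid.vectorspace_piece_space)
  have "submodule base_field (Z \<inter> gpiece J a) (piece_space J a)"
    by (rule submodule.intro[OF V.module_axioms])
      (auto simp: piece_space_def Z_add Z_zero mid.piece_add mid.piece_zero mid.piece_scale
        intro: Z_smult single_in_semigroup_ring mid.zero_mem)
  then show ?thesis using V.subspace_is_vs[of "Z \<inter> gpiece J a"] V.vectorspace_axioms
    by (simp add: subspace_def)
qed

lemma vectorspace_homology: "vectorspace base_field (piece_space H a)"
proof -
  have elim: "\<exists>z. z \<in> Z \<and> z \<in> gpiece J a \<and> z \<in> carrier J \<and> C = B +>\<^bsub>J\<^esub> z" if "C \<in> gpiece H a" for C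
    using that Z_carrier by (auto simp: H_piece)
  have intro: "B +>\<^bsub>J\<^esub> z \<in> gpiece H a" if "z \<in> Z" "z \<in> gpiece J a" for z
    using that by (auto simp: H_piece)
  have zero: "\<zero>\<^bsub>H\<^esub> = B +>\<^bsub>J\<^esub> \<zero>\<^bsub>J\<^esub>"
    using H_coset_zero submodule.zero_closed[OF B_submodule] by simp
  have scale: "Poly_Mapping.single 0 c \<odot>\<^bsub>J\<^esub> z \<in> Z" if "z \<in> Z" for c z
    using that by (intro Z_smult single_in_semigroup_ring mid.zero_mem)
  have neg: "\<ominus>\<^bsub>J\<^esub> z \<in> Z" if "z \<in> Z" for z by (rule submodule_neg[OF Z_submodule that])
  have closed: "Poly_Mapping.single 0 c \<odot>\<^bsub>J\<^esub> z \<in> carrier J" if "z \<in> carrier J" for c z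
    using that by (intro mid.smult_closed single_in_semigroup_ring mid.zero_mem)
  have one: "1 \<odot>\<^bsub>H\<^esub> (B +>\<^bsub>J\<^esub> z) = B +>\<^bsub>J\<^esub> z" if "z \<in> carrier J" for z
    using H_scale[OF that, of 1] mid.one_smult[OF that] by simp
  note [simp] = piece_space_def base_field_def
  show ?thesis
  proof (rule vs_criteria[OF field_base_field], goal_cases)
    case 1
    show ?case using intro[OF Z_zero mid.piece_zero] by (simp add: zero)
  next
    case 2
    show ?case by (auto dest!: elim simp: H_add intro!: intro Z_add mid.piece_add)
  next
    case 3
    show ?case
    proof
      fix C assume "C \<in> carrier (piece_space H a)"
      then obtain z where z: "z \<in> Z" "z \<in> gpiece J a" "z \<in> carrier J" "C = B +>\<^bsub>J\<^esub> z" using elim by auto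
      then show "\<exists>C'\<in>carrier (piece_space H a). C \<oplus>\<^bsub>piece_space H a\<^esub> C' = \<zero>\<^bsub>piece_space H a\<^esub>"
        by (intro bexI[of _ "B +>\<^bsub>J\<^esub> (\<ominus>\<^bsub>J\<^esub> z)"])
          (auto simp: H_add zero mid.r_neg intro!: intro neg mid.piece_neg)
    qed
  next
    case 4
    show ?case by (auto dest!: elim simp: H_scale intro!: intro scale mid.piece_scale)
  qed (auto dest!: elim simp: H_add H_scale one closed zero mid.a_assoc mid.a_comm mid.a_lcomm
      mid.single_smult_single mid.zero_mem mid.single_smult_add mid.single_add_smult)
qed

text \<open>The \<open>n\<close> coordinates separate the cycles of degree \<open>a\<close>, so
  these form a finite-dimensional space, and the homology is its image under a linear map.\<close>

lemma fin_dim_homology: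
  assumes "coordinates Q J n T \<kappa>"
  shows "vectorspace.fin_dim base_field (piece_space H a)"
proof -
  let ?W = "(piece_space J a)\<lparr>carrier := Z \<inter> gpiece J a\<rparr>"
  interpret W: vectorspace base_field ?W by (rule vectorspace_cycles)
  interpret HV: vectorspace base_field "piece_space H a" by (rule vectorspace_homology)
  have zero: "\<kappa> a i \<zero>\<^bsub>J\<^esub> = 0" if "i < n" for i
    using coordinates_scale[OF mid.graded_mod_axioms assms mid.piece_zero that, of a 0] by (simp add: mid.zero_smult)
  have fin: "W.fin_dim"
  proof (rule fin_dim_if_separating_functionals[where \<kappa> = "\<kappa> a" and n = n])
    show "vectorspace base_field ?W" by (rule vectorspace_cycles)
    show "\<kappa> a i (v \<oplus>\<^bsub>?W\<^esub> w) = \<kappa> a i v + \<kappa> a i w"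
      if "i < n" "v \<in> carrier ?W" "w \<in> carrier ?W" for i v w
      using assms that by (simp add: coordinates_def piece_space_def)
    show "\<kappa> a i (c \<odot>\<^bsub>?W\<^esub> v) = c * \<kappa> a i v" if "i < n" "v \<in> carrier ?W" for i c v
      using coordinates_scale[OF mid.graded_mod_axioms assms _ that(1)] that by (simp add: piece_space_def)
    show "v = \<zero>\<^bsub>?W\<^esub>" if v: "v \<in> carrier ?W" "\<And>i. i < n \<Longrightarrow> \<kappa> a i v = 0" for v
    proof -
      have "\<forall>v\<in>gpiece J a. \<forall>w\<in>gpiece J a. (\<forall>i<n. \<kappa> a i v = \<kappa> a i w) \<longrightarrow> v = w"
        using assms by (simp add: coordinates_def)
      then have "v = \<zero>\<^bsub>J\<^esub>" using v zero mid.piece_zero by (auto simp: piece_space_def)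
      then show ?thesis by (simp add: piece_space_def)
    qed
  qed
  have "(\<lambda>z. B +>\<^bsub>J\<^esub> z) \<in> module_hom base_field ?W (piece_space H a)"
    unfolding module_hom_def by (auto simp: piece_space_def H_piece H_add H_scale Z_carrier)
  then interpret q: linear_map base_field ?W "piece_space H a" "\<lambda>z. B +>\<^bsub>J\<^esub> z"
    by unfold_locales
  show ?thesis by (rule q.surj_fin_dim[OF fin]) (simp add: piece_space_def H_piece)
qed

end

section \<open>Transport on homology and its sector partition\<close>

locale transported_cx = graded_cx Q J' d' J d J''
  for Q :: "(int ^ 'd) set"
    and J' :: "('k::field, 'd, 'l) zd_module" and d' :: "'l \<Rightarrow> 'm"
    and J :: "('k, 'd, 'm) zd_module" and d :: "'m \<Rightarrow> 'n"
    and J'' :: "('k, 'd, 'n) zd_module" +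
  fixes \<sigma> :: "int ^ 'd \<Rightarrow> nat set" and t :: "int ^ 'd \<Rightarrow> int ^ 'd \<Rightarrow> 'm \<Rightarrow> 'm"
    and \<pi> :: "int ^ 'd \<Rightarrow> 'p"
  assumes transport: "transport_system Q J \<sigma> t"
    and pattern: "\<pi> a = \<pi> b \<Longrightarrow> \<sigma> a = \<sigma> b"
    and transport_B: "\<lbrakk>\<pi> a = \<pi> b; v \<in> d' ` carrier J'; v \<in> gpiece J a\<rbrakk> \<Longrightarrow> t a b v \<in> d' ` carrier J'"
    and transport_Z: "\<lbrakk>\<pi> a = \<pi> b; v \<in> a_kernel J J'' d; v \<in> gpiece J a\<rbrakk> \<Longrightarrow> t a b v \<in> a_kernel J J'' d"
begin

text \<open>Transport between arbitrary degrees need not respect the differentials. This relation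
  says that the two sectors are linked by some multiplication, as in the condition under which a
  sector partition asks for a map.\<close>

definition reach :: "int ^ 'd \<Rightarrow> int ^ 'd \<Rightarrow> bool"
  where "reach a b \<longleftrightarrow> (\<exists>a1 b1. \<pi> a1 = \<pi> a \<and> \<pi> b1 = \<pi> b \<and> b1 - a1 \<in> Q)"

lemma reach_same: "\<pi> a = \<pi> b \<Longrightarrow> reach a b"
  unfolding reach_def using mid.zero_mem by (intro exI[of _ a]) simp

text \<open>The transport factors as a move inside the first sector, multiplication by a monomial
  from \<open>a1\<close> to \<open>b1\<close>, and a move inside the second sector. Each factor
  preserves cycles and boundaries, and the composition is lossless because each move inside a sector
  keeps the summand set.\<close>

lemma reach_transport:
  assumes "reach a b" "v \<in> gpiece J a"
  shows "v \<in> B \<Longrightarrow> t a b v \<in> B" "v \<in> Z \<Longrightarrow> t a b v \<in> Z"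
proof -
  obtain a1 b1 where ab: "\<pi> a1 = \<pi> a" "\<pi> b1 = \<pi> b" "b1 - a1 \<in> Q"
    using assms(1) by (auto simp: reach_def)
  define w where "w = t a a1 v"
  define x where "x = Poly_Mapping.single (b1 - a1) 1 \<odot>\<^bsub>J\<^esub> w"
  have w: "w \<in> gpiece J a1" unfolding w_def by (rule transport_piece[OF transport assms(2)])
  have x: "x \<in> gpiece J b1" unfolding x_def by (rule mid.piece_shift[OF w ab(3)])
  have "x = t a1 b1 w" using transport_mult[OF transport w ab(3)] by (simp add: x_def)
  also have "\<dots> = t a b1 v" unfolding w_def
    by (rule transport_trans[OF transport assms(2)]) (use pattern[OF ab(1)] in auto)
  finally have "t b1 b x = t b1 b (t a b1 v)" by simp
  also have "\<dots> = t a b v"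
    by (rule transport_trans[OF transport assms(2)]) (use pattern[OF ab(2)] in auto)
  finally have eq: "t a b v = t b1 b x" ..
  note ring = single_in_semigroup_ring[OF ab(3)]
  show "t a b v \<in> B" if "v \<in> B"
  proof -
    have "w \<in> B" unfolding w_def by (rule transport_B[OF ab(1)[symmetric] that assms(2)])
    then have "x \<in> B" unfolding x_def by (rule B_smult[OF ring])
    then show ?thesis unfolding eq by (rule transport_B[OF ab(2) _ x])
  qed
  show "t a b v \<in> Z" if "v \<in> Z"
  proof -
    have "w \<in> Z" unfolding w_def by (rule transport_Z[OF ab(1)[symmetric] that assms(2)])
    then have "x \<in> Z" unfolding x_def by (rule Z_smult[OF ring])
    then show ?thesis unfolding eq by (rule transport_Z[OF ab(2) _ x])
  qed
qed

text \<open>A coset also contains representatives that are not homogeneous, on which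
  \<open>t a b\<close> is not controlled; hence the intersection with the graded piece.\<close>

definition htrans :: "int ^ 'd \<Rightarrow> int ^ 'd \<Rightarrow> 'm set \<Rightarrow> 'm set"
  where "htrans a b C = (\<Union>y\<in>C \<inter> gpiece J a. B +>\<^bsub>J\<^esub> t a b y)"

lemma htrans_coset:
  assumes "reach a b" "z \<in> gpiece J a"
  shows "htrans a b (B +>\<^bsub>J\<^esub> z) = B +>\<^bsub>J\<^esub> t a b z"
  unfolding htrans_def
proof (rule coset_map_eq[OF B_subgroup mid.additive_subgroup_piece _ _ _ assms(2)])
  show "t a b x \<in> carrier J" if "x \<in> gpiece J a" for x
    using mid.piece_carrier transport_piece[OF transport that] by blast
  show "t a b (x \<oplus>\<^bsub>J\<^esub> y) = t a b x \<oplus>\<^bsub>J\<^esub> t a b y" if "x \<in> gpiece J a" "y \<in> gpiece J a" for x y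
    by (rule transport_add[OF transport that])
  show "t a b x \<in> B" if "x \<in> B" "x \<in> gpiece J a" for x
    by (rule reach_transport(1)[OF assms(1) that(2,1)])
qed

lemma H_pieceE:
  assumes "C \<in> gpiece H a"
  obtains z where "z \<in> Z" "z \<in> gpiece J a" "z \<in> carrier J" "C = B +>\<^bsub>J\<^esub> z"
  using assms Z_carrier unfolding H_piece by blast

lemma H_pieceI: "z \<in> Z \<Longrightarrow> z \<in> gpiece J a \<Longrightarrow> B +>\<^bsub>J\<^esub> z \<in> gpiece H a"
  by (auto simp: H_piece)

lemma htrans_piece: "reach a b \<Longrightarrow> C \<in> gpiece H a \<Longrightarrow> htrans a b C \<in> gpiece H b"
  by (elim H_pieceE) (simp add: htrans_coset H_pieceI reach_transport(2) transport_piece[OF transport])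

lemma htrans_module_hom:
  assumes "reach a b"
  shows "htrans a b \<in> LinearCombinations.module_hom base_field (piece_space H a) (piece_space H b)"
proof -
  have "htrans a b (C \<oplus>\<^bsub>H\<^esub> C') = htrans a b C \<oplus>\<^bsub>H\<^esub> htrans a b C'"
    if C: "C \<in> gpiece H a" and C': "C' \<in> gpiece H a" for C C'
  proof -
    obtain z where z: "z \<in> gpiece J a" "z \<in> carrier J" "C = B +>\<^bsub>J\<^esub> z" using C by (rule H_pieceE)
    obtain w where w: "w \<in> gpiece J a" "w \<in> carrier J" "C' = B +>\<^bsub>J\<^esub> w" using C' by (rule H_pieceE)
    show ?thesis
      using z w mid.piece_carrier[OF transport_piece[OF transport z(1)]]
        mid.piece_carrier[OF transport_piece[OF transport w(1)]]
      by (simp add: H_add htrans_coset[OF assms] mid.piece_add transport_add[OF transport])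
  qed
  moreover have "htrans a b (Poly_Mapping.single 0 c \<odot>\<^bsub>H\<^esub> C) = Poly_Mapping.single 0 c \<odot>\<^bsub>H\<^esub> htrans a b C"
    if C: "C \<in> gpiece H a" for C c
  proof -
    obtain z where z: "z \<in> gpiece J a" "z \<in> carrier J" "C = B +>\<^bsub>J\<^esub> z" using C by (rule H_pieceE)
    show ?thesis
      using z mid.piece_carrier[OF transport_piece[OF transport z(1)]]
      by (simp add: H_scale htrans_coset[OF assms] mid.piece_scale transport_scale[OF transport])
  qed
  ultimately show ?thesis
    using htrans_piece[OF assms] unfolding LinearCombinations.module_hom_def by (auto simp: piece_space_def)
qed

lemma htrans_trans:
  assumes "reach a b" "reach b e" "reach a e" "\<sigma> a \<inter> \<sigma> e \<subseteq> \<sigma> b" "C \<in> gpiece H a"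
  shows "htrans b e (htrans a b C) = htrans a e C"
proof -
  obtain z where z: "z \<in> gpiece J a" "C = B +>\<^bsub>J\<^esub> z" using assms(5) by (rule H_pieceE)
  show ?thesis
    using z assms by (simp add: htrans_coset transport_piece[OF transport] transport_trans[OF transport])
qed

lemma htrans_self:
  assumes "C \<in> gpiece H a"
  shows "htrans a a C = C"
proof -
  obtain z where z: "z \<in> gpiece J a" "C = B +>\<^bsub>J\<^esub> z" using assms by (rule H_pieceE)
  show ?thesis
    using z by (simp add: htrans_coset reach_same transport_self[OF mid.graded_mod_axioms transport])
qed

lemma htrans_mult:
  assumes "b - a \<in> Q" "C \<in> gpiece H a"
  shows "Poly_Mapping.single (b - a) 1 \<odot>\<^bsub>H\<^esub> C = htrans a b C"
proof -
  obtain z where z: "z \<in> gpiece J a" "z \<in> carrier J" "C = B +>\<^bsub>J\<^esub> z" using assms(2) by (rule H_pieceE)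
  have "reach a b" using assms(1) by (auto simp: reach_def)
  then show ?thesis
    using z H_smult[OF single_in_semigroup_ring[OF assms(1)] z(2)]
    by (simp add: htrans_coset transport_mult[OF transport z(1) assms(1)])
qed

text \<open>Inside a sector the summand sets agree, so nothing is lost on the way there and back,
  and reverse transport is the inverse.\<close>

lemma htrans_bij:
  assumes "\<pi> a = \<pi> b"
  shows "bij_betw (htrans a b) (gpiece H a) (gpiece H b)"
proof (rule bij_betwI[where g = "htrans b a"])
  have r: "reach a b" "reach b a" "reach a a" "reach b b"
    by (simp_all add: reach_same assms)
  have s: "\<sigma> a = \<sigma> b" by (rule pattern[OF assms])
  show "htrans a b \<in> gpiece H a \<rightarrow> gpiece H b" "htrans b a \<in> gpiece H b \<rightarrow> gpiece H a"
    using htrans_piece r by auto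
  show "htrans b a (htrans a b C) = C" if "C \<in> gpiece H a" for C
    using htrans_trans[OF r(1,2,3) _ that] htrans_self[OF that] s by simp
  show "htrans a b (htrans b a C) = C" if "C \<in> gpiece H b" for C
    using htrans_trans[OF r(2,1,4) _ that] htrans_self[OF that] s by simp
qed

text \<open>The space of a sector is the homology in a representative degree. All identifications
  and structure maps are then instances of transport, and the commuting squares reduce to its
  composition law.\<close>

lemma sector_partition_homology:
  assumes fin: "finite (range \<pi>)" and sector: "\<And>p. is_sector Q {b. \<pi> b = p}"
    and "coordinates Q J n T \<kappa>"
  shows "\<exists>\<S> (V :: (int ^ 'd) set \<Rightarrow> ('k, 'm set) module) \<phi> X. sector_partition Q H \<S> V \<phi> X"
proof -
  define cls where "cls a = {b. \<pi> b = \<pi> a}" for a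
  define rep where "rep S = (SOME a. a \<in> S)" for S :: "(int ^ 'd) set"
  have rep: "\<pi> (rep S) = \<pi> a" if "S \<in> range cls" "a \<in> S" for S a
  proof -
    have "rep S \<in> S" unfolding rep_def using that(2) by (rule someI)
    then show ?thesis using that by (auto simp: cls_def)
  qed
  have cls: "cls a = S" if "S \<in> range cls" "a \<in> S" for S a
    using that by (auto simp: cls_def)
  have fin_cls: "finite (range cls)"
  proof -
    have "range cls = (\<lambda>p. {b. \<pi> b = p}) ` range \<pi>" by (auto simp: cls_def)
    then show ?thesis using fin by simp
  qed
  have "sector_partition Q H (range cls) (\<lambda>S. piece_space H (rep S)) (\<lambda>a. htrans a (rep (cls a)))
      (\<lambda>S T. htrans (rep S) (rep T))"
    unfolding sector_partition_def
  proof (intro conjI ballI impI)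
    show "finite (range cls)" by (rule fin_cls)
    show "partition_on UNIV (range cls)" by (rule partition_onI) (auto simp: cls_def disjnt_def)
    show "is_sector Q S" if "S \<in> range cls" for S using that sector by (auto simp: cls_def)
  next
    fix S assume S: "S \<in> range cls"
    show "vectorspace base_field (piece_space H (rep S))" by (rule vectorspace_homology)
    show "vectorspace.fin_dim base_field (piece_space H (rep S))" by (rule fin_dim_homology[OF assms(3)])
    fix a assume a: "a \<in> S"
    have eq: "\<pi> a = \<pi> (rep S)" using rep[OF S a] by simp
    show "htrans a (rep (cls a)) \<in> LinearCombinations.module_hom base_field (piece_space H a) (piece_space H (rep S))"
      unfolding cls[OF S a] by (rule htrans_module_hom[OF reach_same[OF eq]])
    show "bij_betw (htrans a (rep (cls a))) (gpiece H a) (carrier (piece_space H (rep S)))"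
      using htrans_bij[OF eq] by (simp add: cls[OF S a] piece_space_def)
  next
    fix S T assume S: "S \<in> range cls" and T: "T \<in> range cls" and ex: "\<exists>a\<in>S. \<exists>b\<in>T. b - a \<in> Q"
    have reach: "reach (rep S) (rep T)" using ex rep[OF S] rep[OF T] unfolding reach_def by metis
    then show "htrans (rep S) (rep T)
        \<in> LinearCombinations.module_hom base_field (piece_space H (rep S)) (piece_space H (rep T))"
      by (rule htrans_module_hom)
    fix a b C assume a: "a \<in> S" and b: "b \<in> T" and ab: "b - a \<in> Q" and C: "C \<in> gpiece H a"
    have ea: "\<pi> a = \<pi> (rep S)" and eb: "\<pi> b = \<pi> (rep T)" using rep[OF S a] rep[OF T b] by simp_all
    have r: "reach a b" "reach a (rep T)" using ab eb unfolding reach_def by metis+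
    \<comment> \<open>Both ways round the square equal the direct transport from \<open>a\<close> to
      \<open>rep T\<close>: the intermediate degree \<open>rep S\<close> has the summands of
      \<open>a\<close>, and the intermediate degree \<open>b\<close> has those of
      \<open>rep T\<close>.\<close>
    have "htrans (rep S) (rep T) (htrans a (rep S) C) = htrans a (rep T) C"
      by (rule htrans_trans[OF reach_same[OF ea] reach r(2) _ C]) (use pattern[OF ea] in auto)
    also have "\<dots> = htrans b (rep T) (htrans a b C)"
      by (rule htrans_trans[OF r(1) reach_same[OF eb] r(2) _ C, symmetric]) (use pattern[OF eb] in auto)
    finally show "htrans (rep S) (rep T) (htrans a (rep (cls a)) C)
        = htrans b (rep (cls b)) (Poly_Mapping.single (b - a) 1 \<odot>\<^bsub>H\<^esub> C)"
      by (simp add: cls[OF S a] cls[OF T b] htrans_mult[OF ab C])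
  qed
  then show ?thesis by blast
qed

end

text \<open>Only the identifications change, by composition with the isomorphism; sectors, spaces
  and structure maps are kept. The squares persist because the isomorphism commutes with
  monomials.\<close>

lemma sector_partition_graded_iso:
  assumes part: "sector_partition Q N \<S> V \<phi> X" and M: "graded_mod Q M"
    and \<theta>: "\<theta> \<in> graded_hom Q M N" and bij: "\<And>a. bij_betw \<theta> (gpiece M a) (gpiece N a)"
  shows "sector_partition Q M \<S> V (\<lambda>a. \<phi> a \<circ> \<theta>) X"
proof -
  interpret M: graded_mod Q M by fact
  have \<theta>p: "\<theta> v \<in> gpiece N a" if "v \<in> gpiece M a" for v a by (rule graded_hom_piece[OF \<theta> that])
  have \<theta>_add: "\<theta> (v \<oplus>\<^bsub>M\<^esub> w) = \<theta> v \<oplus>\<^bsub>N\<^esub> \<theta> w" if "v \<in> gpiece M a" "w \<in> gpiece M a" for v w a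
    using that by (intro graded_hom_add[OF \<theta>] M.piece_carrier)
  have \<theta>_mult: "\<theta> (Poly_Mapping.single q c \<odot>\<^bsub>M\<^esub> v) = Poly_Mapping.single q c \<odot>\<^bsub>N\<^esub> \<theta> v"
    if "v \<in> gpiece M a" "q \<in> Q" for v q c a
    using that by (intro graded_hom_smult[OF \<theta>] M.piece_carrier single_in_semigroup_ring)
  have hom: "\<phi> a \<circ> \<theta> \<in> LinearCombinations.module_hom base_field (piece_space M a) W"
    if "\<phi> a \<in> LinearCombinations.module_hom base_field (piece_space N a) W" for a W
    using that \<theta>p \<theta>_add \<theta>_mult[OF _ M.zero_mem]
    by (auto simp: LinearCombinations.module_hom_def piece_space_def)
  show ?thesis
    unfolding sector_partition_def
  proof (intro conjI ballI impI)
    show "finite \<S>" "partition_on UNIV \<S>" using part by (simp_all add: sector_partition_def)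
    show "is_sector Q S" if "S \<in> \<S>" for S using part that by (simp add: sector_partition_def)
  next
    fix S assume S: "S \<in> \<S>"
    show "vectorspace base_field (V S)" "vectorspace.fin_dim base_field (V S)"
      using part S by (simp_all add: sector_partition_def)
    fix a assume a: "a \<in> S"
    show "\<phi> a \<circ> \<theta> \<in> LinearCombinations.module_hom base_field (piece_space M a) (V S)"
      by (rule hom) (use part S a in \<open>simp add: sector_partition_def\<close>)
    have "bij_betw (\<phi> a) (gpiece N a) (carrier (V S))" using part S a by (simp add: sector_partition_def)
    then show "bij_betw (\<phi> a \<circ> \<theta>) (gpiece M a) (carrier (V S))" by (rule bij_betw_trans[OF bij])
  next
    fix S T assume ST: "S \<in> \<S>" "T \<in> \<S>" and ex: "\<exists>a\<in>S. \<exists>b\<in>T. b - a \<in> Q"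
    have *: "X S T \<in> LinearCombinations.module_hom base_field (V S) (V T) \<and>
      (\<forall>a\<in>S. \<forall>b\<in>T. b - a \<in> Q \<longrightarrow>
        (\<forall>v\<in>gpiece N a. X S T (\<phi> a v) = \<phi> b (Poly_Mapping.single (b - a) 1 \<odot>\<^bsub>N\<^esub> v)))"
      using part ST ex unfolding sector_partition_def by blast
    then show "X S T \<in> LinearCombinations.module_hom base_field (V S) (V T)" by blast
    fix a b v assume "a \<in> S" "b \<in> T" "b - a \<in> Q" "v \<in> gpiece M a"
    then show "X S T ((\<phi> a \<circ> \<theta>) v) = (\<phi> b \<circ> \<theta>) (Poly_Mapping.single (b - a) 1 \<odot>\<^bsub>M\<^esub> v)"
      using * \<theta>p[of v a] \<theta>_mult[of v a "b - a" 1] by simp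
  qed
qed

section \<open>Commutation of transport with the differentials\<close>

text \<open>Downward closure is the property of the regions of injective summands, upward closure
  that of flat ones. The disjunction stands outside the quantifiers over regions, so one direction
  holds for the whole family.\<close>

definition directed :: "(int ^ 'd) set \<Rightarrow> (int ^ 'd) set set \<Rightarrow> bool"
  where "directed Q \<T> \<longleftrightarrow> (\<forall>T\<in>\<T>. \<forall>a\<in>T. \<forall>q\<in>Q. a - q \<in> T) \<or> (\<forall>T\<in>\<T>. \<forall>a\<in>T. \<forall>q\<in>Q. a + q \<in> T)"

lemma shifted_diff_diff:
  assumes "is_submonoid Q" "a \<in> shifted_diff \<alpha> F Q" "q \<in> Q"
  shows "a - q \<in> shifted_diff \<alpha> F Q"
proof -
  obtain p b where pb: "p \<in> Q" "b \<in> F" "a = \<alpha> + (b - p)"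
    using assms(2) unfolding mem_shifted_diff by blast
  have "p + q \<in> Q" using assms(1,3) pb(1) by (simp add: is_submonoid_def)
  moreover have "a - q = \<alpha> + (b - (p + q))" using pb(3) by simp
  ultimately show ?thesis using pb(2) unfolding mem_shifted_diff by blast
qed

lemma shifted_diff_add:
  assumes "is_submonoid Q" "a \<in> shifted_diff \<alpha> Q F" "q \<in> Q"
  shows "a + q \<in> shifted_diff \<alpha> Q F"
proof -
  obtain p b where pb: "p \<in> F" "b \<in> Q" "a = \<alpha> + (b - p)"
    using assms(2) unfolding mem_shifted_diff by blast
  have "b + q \<in> Q" using assms(1,3) pb(2) by (simp add: is_submonoid_def)
  moreover have "a + q = \<alpha> + ((b + q) - p)" using pb(3) by simp
  ultimately show ?thesis using pb(1) unfolding mem_shifted_diff by blast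
qed

lemma transport_commute:
  assumes M: "graded_mod Q M" "transport_system Q M (\<lambda>a. {i. i < m \<and> a \<in> S i}) t"
    and N: "graded_mod Q N" "transport_system Q N (\<lambda>a. {i. i < n \<and> a \<in> T i}) s"
    and f: "f \<in> graded_hom Q M N" and gen: "group_closure Q = UNIV"
    and dir: "directed Q (S ` {..<m} \<union> T ` {..<n})"
    and eq: "{i. i < m \<and> a \<in> S i} = {i. i < m \<and> b \<in> S i}" "{i. i < n \<and> a \<in> T i} = {i. i < n \<and> b \<in> T i}"
    and v: "v \<in> gpiece M a"
  shows "f (t a b v) = s a b (f v)"
proof -
  interpret M: graded_mod Q M by fact
  \<comment> \<open>The common bounds come from here: \<open>a - p = b - q\<close> lies below both
    degrees and \<open>a + q = b + p\<close> above both.\<close>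
  obtain p q where pq: "p \<in> Q" "q \<in> Q" "a - b = p - q"
    using group_closure_submonoid_diff[OF M.submonoid, of "a - b"] gen by auto
  have ab: "a + q = b + p" using pq(3) by (metis add.commute add_diff_cancel_left' diff_add_cancel diff_diff_eq2)
  show ?thesis
    using dir unfolding directed_def
  proof
    assume down: "\<forall>T\<in>S ` {..<m} \<union> T ` {..<n}. \<forall>a\<in>T. \<forall>q\<in>Q. a - q \<in> T"
    have e: "b - (a - p) = q" using ab by (metis add_diff_cancel_left' diff_diff_eq2 add.commute)
    show ?thesis
      by (rule transport_commute_below[OF M N f eq(2), of "a - p"]) (use down pq e v in auto)
  next
    assume up: "\<forall>T\<in>S ` {..<m} \<union> T ` {..<n}. \<forall>a\<in>T. \<forall>q\<in>Q. a + q \<in> T"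
    have e: "(a + q) - b = p" using ab by simp
    show ?thesis
      by (rule transport_commute_above[OF M N f eq, of "a + q"]) (use up pq e v in auto)
  qed
qed

lemma (in graded_cx) homology_sector_partition:
  fixes n' n n'' :: nat
  assumes gen: "group_closure Q = UNIV"
    and iso': "graded_iso Q J' (direct_sum {..<n'} (\<lambda>i. monomial_module (T' i))) \<noteq> {}"
    and iso: "graded_iso Q J (direct_sum {..<n} (\<lambda>i. monomial_module (T i))) \<noteq> {}"
    and iso'': "graded_iso Q J'' (direct_sum {..<n''} (\<lambda>i. monomial_module (T'' i))) \<noteq> {}"
    and dir: "directed Q (T' ` {..<n'} \<union> T ` {..<n} \<union> T'' ` {..<n''})"
    and half: "\<And>A. A \<in> T' ` {..<n'} \<union> T ` {..<n} \<union> T'' ` {..<n''} \<Longrightarrow> halfspace_determined Q A"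
  shows "\<exists>\<S> (V :: (int ^ 'd) set \<Rightarrow> ('k, 'm set) module) \<phi> X. sector_partition Q H \<S> V \<phi> X"
proof -
  define \<sigma>' where "\<sigma>' a = {i. i < n' \<and> a \<in> T' i}" for a
  define \<sigma> where "\<sigma> a = {i. i < n \<and> a \<in> T i}" for a
  define \<sigma>'' where "\<sigma>'' a = {i. i < n'' \<and> a \<in> T'' i}" for a
  \<comment> \<open>The tags 0, 1 and 2 keep the summands of the three modules apart in a single
    index set.\<close>
  define I where "I = {0::nat} \<times> {..<n'} \<union> {1} \<times> {..<n} \<union> {2} \<times> {..<n''}"
  define TT where "TT x = (if fst x = 0 then T' (snd x) else if fst x = 1 then T (snd x) else T'' (snd x))"
    for x :: "nat \<times> nat"
  define \<pi> where "\<pi> a = {x \<in> I. a \<in> TT x}" for a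
  have \<sigma>_\<pi>: "\<sigma>' a = {i. (0, i) \<in> \<pi> a}" "\<sigma> a = {i. (1, i) \<in> \<pi> a}" "\<sigma>'' a = {i. (2, i) \<in> \<pi> a}" for a
    by (auto simp: \<sigma>'_def \<sigma>_def \<sigma>''_def \<pi>_def I_def TT_def)
  obtain \<kappa>' where \<kappa>': "coordinates Q J' n' T' \<kappa>'"
    using coordinates_exist[OF src.graded_mod_axioms iso'] by blast
  obtain \<kappa> where \<kappa>: "coordinates Q J n T \<kappa>"
    using coordinates_exist[OF mid.graded_mod_axioms iso] by blast
  obtain \<kappa>'' where \<kappa>'': "coordinates Q J'' n'' T'' \<kappa>''"
    using coordinates_exist[OF tgt.graded_mod_axioms iso''] by blast
  obtain t' where t': "transport_system Q J' \<sigma>' t'"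
    unfolding \<sigma>'_def using transport_system_exists[OF src.graded_mod_axioms \<kappa>'] by blast
  obtain t where t: "transport_system Q J \<sigma> t"
    unfolding \<sigma>_def using transport_system_exists[OF mid.graded_mod_axioms \<kappa>] by blast
  obtain t'' where t'': "transport_system Q J'' \<sigma>'' t''"
    unfolding \<sigma>''_def using transport_system_exists[OF tgt.graded_mod_axioms \<kappa>''] by blast
  have comm': "d' (t' a b v) = t a b (d' v)" if "\<pi> a = \<pi> b" "v \<in> gpiece J' a" for a b v
  proof (rule transport_commute[OF src.graded_mod_axioms t'[unfolded \<sigma>'_def] mid.graded_mod_axioms
        t[unfolded \<sigma>_def] hom_src gen])
    show "directed Q (T' ` {..<n'} \<union> T ` {..<n})" using dir unfolding directed_def by blast
  qed (use \<sigma>_\<pi> that in \<open>auto simp: \<sigma>'_def[symmetric] \<sigma>_def[symmetric]\<close>)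
  have comm: "d (t a b v) = t'' a b (d v)" if "\<pi> a = \<pi> b" "v \<in> gpiece J a" for a b v
  proof (rule transport_commute[OF mid.graded_mod_axioms t[unfolded \<sigma>_def] tgt.graded_mod_axioms
        t''[unfolded \<sigma>''_def] hom_mid gen])
    show "directed Q (T ` {..<n} \<union> T'' ` {..<n''})" using dir unfolding directed_def by blast
  qed (use \<sigma>_\<pi> that in \<open>auto simp: \<sigma>_def[symmetric] \<sigma>''_def[symmetric]\<close>)
  interpret tc: transported_cx Q J' d' J d J'' \<sigma> t \<pi>
  proof unfold_locales
    show "transport_system Q J \<sigma> t" by (rule t)
    show "\<sigma> a = \<sigma> b" if "\<pi> a = \<pi> b" for a b using that by (simp add: \<sigma>_\<pi>)
    show "t a b v \<in> B" if ab: "\<pi> a = \<pi> b" and v: "v \<in> B" "v \<in> gpiece J a" for a b v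
    proof -
      \<comment> \<open>Transport of \<open>J'\<close> acts on graded pieces, so the boundary needs
        a homogeneous preimage before it can be moved.\<close>
      obtain u where u: "u \<in> gpiece J' a" "v = d' u" using B_piece[OF v] by blast
      have "t a b v = d' (t' a b u)" using comm'[OF ab u(1)] u(2) by simp
      then show ?thesis using src.piece_carrier[OF transport_piece[OF t' u(1)]] by blast
    qed
    show "t a b v \<in> Z" if ab: "\<pi> a = \<pi> b" and v: "v \<in> Z" "v \<in> gpiece J a" for a b v
      using comm[OF ab v(2)] v(1) transport_zero[OF tgt.graded_mod_axioms t'']
        mid.piece_carrier[OF transport_piece[OF t v(2)]] by (simp add: Z_iff)
  qed
  have finI: "finite I" by (simp add: I_def)
  show ?thesis
  proof (rule tc.sector_partition_homology[OF _ _ \<kappa>])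
    have "range \<pi> \<subseteq> Pow I" by (auto simp: \<pi>_def)
    then show "finite (range \<pi>)" using finI by (simp add: finite_subset)
    show "is_sector Q {b. \<pi> b = p}" for p
      unfolding \<pi>_def
    proof (rule is_sector_pattern_class[OF finI])
      show "halfspace_determined Q (TT x)" if "x \<in> I" for x
        using that by (intro half) (auto simp: I_def TT_def)
    qed
  qed
qed

text \<open>Dependence on the complex alone is expressed by the order of quantifiers: sectors,
  spaces and structure maps are fixed for the concrete quotient of cycles by boundaries, before any
  graded module isomorphic to it is considered.\<close>

theorem theorem5p2:
  fixes Q :: "(int ^ 'd) set"
    and J' :: "('k::field, 'd, 'l) zd_module"
    and J :: "('k, 'd, 'm) zd_module"
    and J'' :: "('k, 'd, 'n) zd_module"
    and d' :: "'l \<Rightarrow> 'm" and d :: "'m \<Rightarrow> 'n"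
  assumes "affine_semigroup Q" and "sharp Q" and "saturated Q" and "group_closure Q = UNIV"
    and "graded_complex Q J' d' J d J''"
    and "injective_module Q J' \<and> injective_module Q J \<and> injective_module Q J'' \<or>
         flat_module Q J' \<and> flat_module Q J \<and> flat_module Q J''"
  shows "\<exists>(\<S> :: (int ^ 'd) set set) (V :: (int ^ 'd) set \<Rightarrow> ('k, 'm set) module) \<phi> X.
      sector_partition Q (middle_homology J' d' J d J'') \<S> V \<phi> X \<and>
      (\<forall>(H :: ('k, 'd, 'h) zd_module) \<theta>.
         is_graded_module Q H \<and> \<theta> \<in> graded_iso Q H (middle_homology J' d' J d J'') \<longrightarrow>
         sector_partition Q H \<S> V (\<lambda>\<alpha>. \<phi> \<alpha> \<circ> \<theta>) X)"
proof -
  have Q: "is_submonoid Q" by (rule affine_semigroup_is_submonoid[OF assms(1)])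
  interpret graded_cx Q J' d' J d J'' by unfold_locales (rule Q assms(5))+
  have "\<exists>\<S> (V :: (int ^ 'd) set \<Rightarrow> ('k, 'm set) module) \<phi> X. sector_partition Q H \<S> V \<phi> X"
    using assms(6)
  proof
    assume inj: "injective_module Q J' \<and> injective_module Q J \<and> injective_module Q J''"
    obtain n' :: nat and \<alpha>' F' where 1: "\<forall>i<n'. face Q (F' i)"
        "graded_iso Q J' (direct_sum {..<n'} (\<lambda>i. monomial_module (shifted_diff (\<alpha>' i) (F' i) Q))) \<noteq> {}"
      using inj unfolding injective_module_def by blast
    obtain n :: nat and \<alpha> F where 2: "\<forall>i<n. face Q (F i)"
        "graded_iso Q J (direct_sum {..<n} (\<lambda>i. monomial_module (shifted_diff (\<alpha> i) (F i) Q))) \<noteq> {}"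
      using inj unfolding injective_module_def by blast
    obtain n'' :: nat and \<alpha>'' F'' where 3: "\<forall>i<n''. face Q (F'' i)"
        "graded_iso Q J'' (direct_sum {..<n''} (\<lambda>i. monomial_module (shifted_diff (\<alpha>'' i) (F'' i) Q))) \<noteq> {}"
      using inj unfolding injective_module_def by blast
    show ?thesis
    proof (rule homology_sector_partition[OF assms(4) 1(2) 2(2) 3(2)])
      show "directed Q ((\<lambda>i. shifted_diff (\<alpha>' i) (F' i) Q) ` {..<n'} \<union> (\<lambda>i. shifted_diff (\<alpha> i) (F i) Q) ` {..<n}
          \<union> (\<lambda>i. shifted_diff (\<alpha>'' i) (F'' i) Q) ` {..<n''})"
        unfolding directed_def by (rule disjI1) (auto intro: shifted_diff_diff[OF Q])
    qed (use 1(1) 2(1) 3(1) in \<open>auto intro: halfspace_determined_injective[OF assms(1,3,4)]\<close>)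
  next
    assume flat: "flat_module Q J' \<and> flat_module Q J \<and> flat_module Q J''"
    obtain n' :: nat and \<alpha>' F' where 1: "\<forall>i<n'. face Q (F' i)"
        "graded_iso Q J' (direct_sum {..<n'} (\<lambda>i. monomial_module (shifted_diff (\<alpha>' i) Q (F' i)))) \<noteq> {}"
      using flat unfolding flat_module_def by blast
    obtain n :: nat and \<alpha> F where 2: "\<forall>i<n. face Q (F i)"
        "graded_iso Q J (direct_sum {..<n} (\<lambda>i. monomial_module (shifted_diff (\<alpha> i) Q (F i)))) \<noteq> {}"
      using flat unfolding flat_module_def by blast
    obtain n'' :: nat and \<alpha>'' F'' where 3: "\<forall>i<n''. face Q (F'' i)"
        "graded_iso Q J'' (direct_sum {..<n''} (\<lambda>i. monomial_module (shifted_diff (\<alpha>'' i) Q (F'' i)))) \<noteq> {}"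
      using flat unfolding flat_module_def by blast
    show ?thesis
    proof (rule homology_sector_partition[OF assms(4) 1(2) 2(2) 3(2)])
      show "directed Q ((\<lambda>i. shifted_diff (\<alpha>' i) Q (F' i)) ` {..<n'} \<union> (\<lambda>i. shifted_diff (\<alpha> i) Q (F i)) ` {..<n}
          \<union> (\<lambda>i. shifted_diff (\<alpha>'' i) Q (F'' i)) ` {..<n''})"
        unfolding directed_def by (rule disjI2) (auto intro: shifted_diff_add[OF Q])
    qed (use 1(1) 2(1) 3(1) in \<open>auto intro: halfspace_determined_flat[OF assms(1,3,4)]\<close>)
  qed
  then obtain \<S> and V :: "(int ^ 'd) set \<Rightarrow> ('k, 'm set) module" and \<phi> X
    where part: "sector_partition Q H \<S> V \<phi> X" by blast
  have "sector_partition Q G \<S> V (\<lambda>\<alpha>. \<phi> \<alpha> \<circ> \<theta>) X"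
    if G: "is_graded_module Q G" and \<theta>: "\<theta> \<in> graded_iso Q G H" for G :: "('k, 'd, 'h) zd_module" and \<theta>
  proof -
    have "graded_mod Q G" using Q G by (simp add: graded_mod_def)
    moreover have "\<theta> \<in> graded_hom Q G H" using \<theta> by (simp add: graded_iso_def)
    ultimately show ?thesis
      using graded_iso_homology_bij_pieces[OF _ \<theta>] by (intro sector_partition_graded_iso[OF part]) auto
  qed
  with part show ?thesis by blast
qed

end
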